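(* The only class II minimal admissible manifold of the group $G=SO^0_{1,n}$ is the manifold $M=SO^0_{1,n}/SO_{n-1}$. It has the reductive decomposition $$\mathfrak{so}_{1,n}=\mathfrak{so}(V)=\mathfrak{so}(W)+\bigl(\mathbb R(e_0\wedge e_1)+e_0\wedge W+e_1\wedge W\bigr),$$ where $\mathbb R^{1,n}=V=\mathbb Re_0+\mathbb Re_1+W$ is an orthogonal decomposition of the Minkowski space $V$. In particular, $\mathfrak m^H=\mathbb R(e_0\wedge e_1)$.
   Context: $G=SO^0_{1,n}$ is considered as a simple noncompact Lie group of real rank one. $V=\mathbb R^{1,n}$ is Minkowski space, $e_0$ is a unit time-like vector ($e_0^2=-1$), $e_1$ is a unit vector in $E=e_0^\perp$, $W$ is the orthogonal complement of $e_1$ in $E$; $\mathfrak{so}(V)$ is identified with the space $\Lambda^2V$ of bivectors, and $H=SO_{n-1}=SO(W)$, $\mathfrak h=\mathfrak{so}(W)=\Lambda^2W$, $\mathfrak m$ is the complement in the displayed decomposition, and $\mathfrak m^H$ is the space of $\mathrm{Ad}_H$-invariant vectors in $\mathfrak m$. Lie groups and stability subgroups are connected. A homogeneous manifold $G/H$ with compact connected $H$ is admissible if it admits a $G$-invariant Lorentzian metric; it is minimal admissible if there is no connected compact subgroup $\tilde H$ containing $H$ properly with $G/\tilde H$ admissible. For a maximal compact subgroup $K\supset H$ of $G$ with symmetric decomposition $\mathfrak g=\mathfrak k+\mathfrak p$ of $G/K$, an admissible manifold $G/H$ belongs to the class II if $\mathfrak p^H\ne0$, where $\mathfrak p^H$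 is the space of $\mathrm{Ad}_H$-invariant vectors in $\mathfrak p$.
   Formalization: The final claim m^H = R(e_0∧e_1) is stated only for n ≥ 3: for n = 2 the group H = SO_1 is trivial, so m^H = m = so(1,2) is three-dimensional and the claim fails; everything else is for all n ≥ 2. *)

theory Defs
  imports "HOL-Analysis.Analysis"
begin

section \<open>Matrix groups and their Lie algebras\<close>

type_synonym 'm mat = "real ^ 'm ^ 'm"

definition matrix_group :: "('m::finite) mat set \<Rightarrow> bool" where
  "matrix_group S \<longleftrightarrow> mat 1 \<in> S \<and> (\<forall>A\<in>S. \<forall>B\<in>S. A ** B \<in> S)
     \<and> (\<forall>A\<in>S. invertible A \<and> matrix_inv A \<in> S)"

text \<open>The Lie algebra of a closed matrix group, as its tangent space at the identity: the velocities
  of curves in the group through the identity.\<close>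

definition lie_alg :: "('m::finite) mat set \<Rightarrow> 'm mat set" where
  "lie_alg S = {X. \<exists>\<gamma>::real \<Rightarrow> 'm mat. \<gamma> 0 = mat 1 \<and> (\<forall>t. \<gamma> t \<in> S)
     \<and> (\<gamma> has_vector_derivative X) (at 0)}"

definition Ad :: "('m::finite) mat \<Rightarrow> 'm mat \<Rightarrow> 'm mat" where
  "Ad g X = g ** X ** matrix_inv g"

definition lie_bracket :: "('m::finite) mat \<Rightarrow> 'm mat \<Rightarrow> 'm mat" where
  "lie_bracket X Y = X ** Y - Y ** X"

definition Ad_fixed :: "('m::finite) mat set \<Rightarrow> 'm mat set \<Rightarrow> 'm mat set" where
  "Ad_fixed H S = {X \<in> S. \<forall>h\<in>H. Ad h X = X}"

definition direct_sum :: "'a::real_vector set \<Rightarrow> 'a set \<Rightarrow> 'a set \<Rightarrow> bool" where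
  "direct_sum S A B \<longleftrightarrow> subspace A \<and> subspace B \<and> A \<inter> B = {0} \<and> S = {a + b | a b. a \<in> A \<and> b \<in> B}"

definition reductive_decomposition ::
    "('m::finite) mat set \<Rightarrow> 'm mat set \<Rightarrow> 'm mat set \<Rightarrow> bool" where
  "reductive_decomposition G H M \<longleftrightarrow>
     direct_sum (lie_alg G) (lie_alg H) M \<and> (\<forall>h\<in>H. \<forall>X\<in>M. Ad h X \<in> M)"

definition symmetric_decomposition ::
    "('m::finite) mat set \<Rightarrow> 'm mat set \<Rightarrow> 'm mat set \<Rightarrow> bool" where
  "symmetric_decomposition G K P \<longleftrightarrow>
     direct_sum (lie_alg G) (lie_alg K) P
     \<and> (\<forall>X\<in>lie_alg K. \<forall>Y\<in>P. lie_bracket X Y \<in> P)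
     \<and> (\<forall>X\<in>P. \<forall>Y\<in>P. lie_bracket X Y \<in> lie_alg K)"

section \<open>Smooth functions\<close>

primrec Ck_on :: "nat \<Rightarrow> 'a::euclidean_space set \<Rightarrow> ('a \<Rightarrow> real) \<Rightarrow> bool" where
  "Ck_on 0 U f \<longleftrightarrow> continuous_on U f"
| "Ck_on (Suc k) U f \<longleftrightarrow> f differentiable_on U \<and> (\<forall>v. Ck_on k U (\<lambda>x. frechet_derivative f (at x) v))"

text \<open>Smoothness on a subset, by local smooth extension to open sets of the ambient space.
  On an embedded submanifold this is the usual smoothness.\<close>

definition smooth_on :: "'a::euclidean_space set \<Rightarrow> ('a \<Rightarrow> real) \<Rightarrow> bool" where
  "smooth_on S f \<longleftrightarrow> (\<forall>x\<in>S. \<exists>U F. open U \<and> x \<in> U \<and> (\<forall>k. Ck_on k U F) \<and> (\<forall>y\<in>S \<inter> U. F y = f y))"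

section \<open>Invariant Lorentzian metrics on homogeneous manifolds\<close>

text \<open>A scalar product of Lorentzian signature on the quotient space \<open>S / R\<close>, written as a bilinear
  form on \<open>S\<close> whose radical is exactly \<open>R\<close>: it is nondegenerate on the quotient, and
  its index (the maximal dimension of a negative definite subspace) is one. A negative
  definite subspace of \<open>S\<close> meets \<open>R\<close> trivially, so dimensions may be measured in \<open>S\<close>.\<close>

definition symmetric_form_on :: "'a::real_vector set \<Rightarrow> ('a \<Rightarrow> 'a \<Rightarrow> real) \<Rightarrow> bool" where
  "symmetric_form_on S q \<longleftrightarrow> (\<forall>X\<in>S. \<forall>Y\<in>S. q X Y = q Y X)
     \<and> (\<forall>X\<in>S. \<forall>Y\<in>S. \<forall>Z\<in>S. \<forall>a b. q (a *\<^sub>R X + b *\<^sub>R Y) Z = a * q X Z + b * q Y Z)"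

definition negative_definite_on :: "'a::real_vector set \<Rightarrow> ('a \<Rightarrow> 'a \<Rightarrow> real) \<Rightarrow> bool" where
  "negative_definite_on U q \<longleftrightarrow> (\<forall>X\<in>U. X \<noteq> 0 \<longrightarrow> q X X < 0)"

definition lorentzian_form :: "'a::euclidean_space set \<Rightarrow> 'a set \<Rightarrow> ('a \<Rightarrow> 'a \<Rightarrow> real) \<Rightarrow> bool" where
  "lorentzian_form S R q \<longleftrightarrow> symmetric_form_on S q
     \<and> {X \<in> S. \<forall>Y\<in>S. q X Y = 0} = R
     \<and> (\<exists>U. subspace U \<and> U \<subseteq> S \<and> negative_definite_on U q \<and> dim U = 1)
     \<and> (\<forall>U. subspace U \<and> U \<subseteq> S \<and> negative_definite_on U q \<longrightarrow> dim U \<le> 1)"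

text \<open>Points of \<open>G/H\<close> are the left cosets, and \<open>G\<close> acts on them by left translation.\<close>

definition left_coset :: "('m::finite) mat \<Rightarrow> 'm mat set \<Rightarrow> 'm mat set" where
  "left_coset g H = (\<lambda>h. g ** h) ` H"

definition cosets :: "('m::finite) mat set \<Rightarrow> 'm mat set \<Rightarrow> 'm mat set set" where
  "cosets G H = (\<lambda>g. left_coset g H) ` G"

definition stabilizer :: "('m::finite) mat set \<Rightarrow> 'm mat set \<Rightarrow> 'm mat set" where
  "stabilizer G p = {a \<in> G. left_coset a p = p}"

text \<open>
  The fundamental vector fields \<open>X\<^sup>*\<close>, with \<open>X\<^sup>*\<close> at \<open>p\<close> the velocity of \<open>exp (t X) p\<close>, identify
  the tangent space of \<open>G/H\<close> at \<open>p\<close> with the quotient of \<open>lie_alg G\<close> by the Lie algebra of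
  the stabilizer of \<open>p\<close>. A metric on \<open>G/H\<close> is therefore a family \<open>Q p\<close> of forms on \<open>lie_alg G\<close>,
  where \<open>Q p X Y\<close> is the scalar product of \<open>X\<^sup>*\<close> and \<open>Y\<^sup>*\<close> at \<open>p\<close>.
  It is smooth iff all functions \<open>p \<mapsto> Q p X Y\<close> are, because the fields \<open>X\<^sup>*\<close> are smooth and
  span every tangent space; and a function on \<open>G/H\<close> is smooth iff its pullback to \<open>G\<close> is.
  The differential of the action of \<open>a\<close> maps \<open>X\<^sup>*\<close> at \<open>p\<close> to \<open>(Ad a X)\<^sup>*\<close> at \<open>a p\<close>.\<close>

definition lorentzian_metric ::
    "('m::finite) mat set \<Rightarrow> 'm mat set \<Rightarrow> ('m mat set \<Rightarrow> 'm mat \<Rightarrow> 'm mat \<Rightarrow> real) \<Rightarrow> bool" where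
  "lorentzian_metric G H Q \<longleftrightarrow>
     (\<forall>p\<in>cosets G H. lorentzian_form (lie_alg G) (lie_alg (stabilizer G p)) (Q p))
     \<and> (\<forall>X\<in>lie_alg G. \<forall>Y\<in>lie_alg G. smooth_on G (\<lambda>g. Q (left_coset g H) X Y))"

definition invariant_metric ::
    "('m::finite) mat set \<Rightarrow> 'm mat set \<Rightarrow> ('m mat set \<Rightarrow> 'm mat \<Rightarrow> 'm mat \<Rightarrow> real) \<Rightarrow> bool" where
  "invariant_metric G H Q \<longleftrightarrow>
     (\<forall>a\<in>G. \<forall>p\<in>cosets G H. \<forall>X\<in>lie_alg G. \<forall>Y\<in>lie_alg G.
        Q (left_coset a p) (Ad a X) (Ad a Y) = Q p X Y)"

definition compact_connected_subgroup :: "('m::finite) mat set \<Rightarrow> 'm mat set \<Rightarrow> bool" where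
  "compact_connected_subgroup G H \<longleftrightarrow> matrix_group H \<and> H \<subseteq> G \<and> compact H \<and> connected H"

definition admissible :: "('m::finite) mat set \<Rightarrow> 'm mat set \<Rightarrow> bool" where
  "admissible G H \<longleftrightarrow> compact_connected_subgroup G H
     \<and> (\<exists>Q. lorentzian_metric G H Q \<and> invariant_metric G H Q)"

definition minimal_admissible :: "('m::finite) mat set \<Rightarrow> 'm mat set \<Rightarrow> bool" where
  "minimal_admissible G H \<longleftrightarrow> admissible G H
     \<and> \<not> (\<exists>H'. compact_connected_subgroup G H' \<and> H \<subset> H' \<and> admissible G H')"

definition maximal_compact_subgroup :: "('m::finite) mat set \<Rightarrow> 'm mat set \<Rightarrow> bool" where
  "maximal_compact_subgroup G K \<longleftrightarrow> matrix_group K \<and> K \<subseteq> G \<and> compact K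
     \<and> \<not> (\<exists>K'. matrix_group K' \<and> K' \<subseteq> G \<and> compact K' \<and> K \<subset> K')"

definition class_II :: "('m::finite) mat set \<Rightarrow> 'm mat set \<Rightarrow> bool" where
  "class_II G H \<longleftrightarrow> admissible G H
     \<and> (\<exists>K P. maximal_compact_subgroup G K \<and> H \<subseteq> K \<and> symmetric_decomposition G K P
            \<and> Ad_fixed H P \<noteq> {0})"

section \<open>Minkowski space and the Lorentz group\<close>

text \<open>Minkowski space of signature \<open>(1, n)\<close> is \<open>real ^ 'n option\<close> with \<open>n = CARD('n)\<close>; the index
  \<open>None\<close> is the time coordinate.\<close>

definition mink :: "real ^ ('n::finite) option \<Rightarrow> real ^ 'n option \<Rightarrow> real" where
  "mink x y = - (x $ None * y $ None) + (\<Sum>i\<in>UNIV. x $ Some i * y $ Some i)"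

definition mink_orth :: "(real ^ ('n::finite) option) set \<Rightarrow> (real ^ 'n option) set" where
  "mink_orth S = {x. \<forall>y\<in>S. mink x y = 0}"

text \<open>For a nondegenerate subspace \<open>U\<close>, the groups \<open>SO(U)\<close> and the algebras \<open>so(U)\<close> act on the
  whole space, trivially on the orthogonal complement of \<open>U\<close>.\<close>

definition SO_of :: "(real ^ ('n::finite) option) set \<Rightarrow> ('n option) mat set" where
  "SO_of U = {A. (\<forall>x y. mink (A *v x) (A *v y) = mink x y) \<and> det A = 1
     \<and> (\<forall>x\<in>mink_orth U. A *v x = x)}"

definition so_of :: "(real ^ ('n::finite) option) set \<Rightarrow> ('n option) mat set" where
  "so_of U = {X. (\<forall>x y. mink (X *v x) y + mink x (X *v y) = 0) \<and> (\<forall>x\<in>mink_orth U. X *v x = 0)}"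

definition SO0_1n :: "('n::finite option) mat set" where
  "SO0_1n = connected_component_set (SO_of UNIV) (mat 1)"

text \<open>The bivector \<open>x \<and> y\<close>, identified with the endomorphism \<open>z \<mapsto> \<langle>y, z\<rangle> x - \<langle>x, z\<rangle> y\<close>.\<close>

definition wedge :: "real ^ ('n::finite) option \<Rightarrow> real ^ 'n option \<Rightarrow> ('n option) mat" where
  "wedge x y = matrix (\<lambda>z. mink y z *\<^sub>R x - mink x z *\<^sub>R y)"

definition bivectors :: "(real ^ ('n::finite) option) set \<Rightarrow> ('n option) mat set" where
  "bivectors U = span {wedge x y | x y. x \<in> U \<and> y \<in> U}"

end

theory Submission
  imports Defs
begin

text \<open>
  Call \<open>(a, b)\<close> a hyperbolic pair if \<open>a\<close> and \<open>b\<close> are orthogonal with squares \<open>-1\<close> and \<open>1\<close>; its isotropy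
  group consists of the elements of \<open>SO(V)\<close> that fix \<open>a\<close> and \<open>b\<close>. The groups
  conjugate to \<open>SO(W)\<close> are the isotropy groups of hyperbolic pairs (\<open>SO_of_conj\<close>), since the identity
  component of the Lorentz group is transitive on these pairs up to the sign of \<open>a\<close>
  (\<open>SO0_transitive_pairs\<close>). So the classification says that a subgroup is minimal admissible of
  class II exactly if it is the isotropy group of a hyperbolic pair.

  Two facts carry the argument. A compact subgroup of the identity component fixes a unit timelike
  vector \<open>f\<close> (\<open>compact_subgroup_fixes_timelike\<close>), and so the maximal compact subgroups are the groups
  \<open>SO(f\<^sup>\<bottom>)\<close>. And the isotropy group of a pair admits an invariant Lorentz metric: on
  \<open>A + s a \<and> b + a \<and> w + b \<and> w'\<close> with \<open>A\<close> in the isotropy algebra, it is \<open>mink w w + mink w' w' - s\<^sup>2\<close>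
  at the base point, and moving the pair transports it to the other points (\<open>admissible_SO_of\<close>).

  Let \<open>H\<close> be minimal admissible of class II, contained in \<open>K = SO(f\<^sup>\<bottom>)\<close>, and let \<open>X\<close> be a nonzero vector of
  \<open>\<pp>\<close> fixed by \<open>H\<close>. As \<open>X\<close> is not in the Lie algebra of \<open>K\<close>, the vector \<open>x = X f\<close> is nonzero, and \<open>H\<close> fixes both
  \<open>f\<close> and \<open>x\<close>. So \<open>H\<close> lies in the isotropy group of the pair obtained from \<open>f\<close> and \<open>x\<close>, which is admissible,
  and minimality forces equality (\<open>minimal_class_II_imp_SO_of\<close>).

  Conversely let \<open>H'\<close> be a compact connected group strictly larger than such an isotropy group. It fixes a
  unit timelike \<open>f\<close>, and the smaller group is the isotropy group of a pair \<open>(f, b)\<close>. The \<open>H'\<close>-orbit of \<open>b\<close> is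
  connected and a union of latitudes around \<open>b\<close>, hence contains a cap of the unit sphere of \<open>f\<^sup>\<bottom>\<close>;
  it is therefore open, and being compact it is the whole sphere. So \<open>H' = SO(f\<^sup>\<bottom>)\<close>
  (\<open>connected_group_contains_rotations\<close>). On the quotient by this group an invariant form is a multiple of
  the definite form of \<open>f\<^sup>\<bottom>\<close>, which is never Lorentzian (\<open>not_admissible_full_rotations\<close>).

  Products of two reflections serve throughout: sliding one mirror along a segment connects them to the
  identity, which yields transitivity, connectedness and, by differentiation, the bivectors as
  elements of the Lie algebra.
\<close>

section \<open>The Minkowski form\<close>

lemma sum_UNIV_option: "(\<Sum>i\<in>UNIV. f i) = f None + (\<Sum>i\<in>UNIV. f (Some i))"
  for f :: "'n::finite option \<Rightarrow> real"
  by (simp add: UNIV_option_conv sum.reindex)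

lemma mink_inner: "mink x y = inner x y - 2 * (x $ None * y $ None)"
  by (simp add: mink_def inner_vec_def sum_UNIV_option)

lemma mink_sym: "mink x y = mink y x"
  by (simp add: mink_inner inner_commute mult.commute)

lemma bilinear_mink: "bilinear (mink :: real ^ ('n::finite) option \<Rightarrow> _)"
  unfolding bilinear_def
  by (auto intro!: linearI simp: mink_inner inner_add_left inner_add_right algebra_simps)

lemma bounded_bilinear_mink: "bounded_bilinear (mink :: real ^ ('n::finite) option \<Rightarrow> _)"
  using bilinear_mink by (simp add: bilinear_conv_bounded_bilinear)

interpretation mink: bounded_bilinear "mink :: real ^ ('n::finite) option \<Rightarrow> _"
  by (rule bounded_bilinear_mink)

lemmas mink_simps [simp] = mink.add_left mink.add_right mink.diff_left mink.diff_right
  mink.scaleR_left mink.scaleR_right mink.minus_left mink.minus_right mink.zero_left mink.zero_right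

lemma mink_axis: "mink (axis i 1) z = (if i = None then - (z $ i) else z $ i)"
proof -
  have "axis i (1::real) $ None = (if i = None then 1 else 0)" by (simp add: axis_def)
  then show ?thesis by (simp add: mink_inner inner_axis')
qed

lemma mink_nondegenerate:
  assumes "\<And>y. mink x y = 0" shows "x = 0"
proof -
  have "x $ i = 0" for i
    using assms[of "axis i 1"] mink_axis[of i x] mink_sym[of x "axis i 1"] by (auto split: if_splits)
  then show ?thesis by (simp add: vec_eq_iff)
qed

definition space_part :: "real ^ ('n::finite) option \<Rightarrow> real ^ 'n" where
  "space_part x = (\<chi> i. x $ Some i)"

lemma mink_space_part: "mink x y = inner (space_part x) (space_part y) - x $ None * y $ None"
  by (simp add: mink_def space_part_def inner_vec_def)

lemma space_part_eq_0: "space_part v = 0 \<Longrightarrow> v $ None = 0 \<Longrightarrow> v = 0"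
  unfolding vec_eq_iff space_part_def
  by (metis option.exhaust vec_lambda_beta zero_index)

lemma timelike_norm_less:
  assumes "mink u u < 0" shows "norm (space_part u) < \<bar>u $ None\<bar>"
proof (rule power2_less_imp_less)
  show "(norm (space_part u))\<^sup>2 < \<bar>u $ None\<bar>\<^sup>2"
    using assms by (simp add: mink_space_part power2_norm_eq_inner) (simp add: power2_eq_square)
qed simp

text \<open>Cauchy-Schwarz on the spatial parts: a vector orthogonal to a timelike one cannot have a time
  component that dominates its spatial part.\<close>

lemma mink_pos_orth_timelike:
  assumes u: "mink u u < 0" and orth: "mink u v = 0" and v: "v \<noteq> 0"
  shows "mink v v > 0"
proof (rule ccontr)
  assume "\<not> mink v v > 0"
  then have "(norm (space_part v))\<^sup>2 \<le> \<bar>v $ None\<bar>\<^sup>2"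
    by (simp add: mink_space_part power2_norm_eq_inner) (simp add: power2_eq_square)
  then have le: "norm (space_part v) \<le> \<bar>v $ None\<bar>"
    by (rule power2_le_imp_le) simp
  have "\<bar>u $ None\<bar> * \<bar>v $ None\<bar> = \<bar>inner (space_part u) (space_part v)\<bar>"
    using orth by (simp add: mink_space_part abs_mult)
  also have "\<dots> \<le> norm (space_part u) * norm (space_part v)"
    by (rule Cauchy_Schwarz_ineq2)
  also have "\<dots> \<le> norm (space_part u) * \<bar>v $ None\<bar>"
    using le by (intro mult_left_mono) auto
  finally have "(\<bar>u $ None\<bar> - norm (space_part u)) * \<bar>v $ None\<bar> \<le> 0"
    by (simp add: algebra_simps)
  with timelike_norm_less[OF u] have "v $ None = 0"
    by (simp add: mult_le_0_iff)
  with le have "v = 0"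
    by (intro space_part_eq_0) auto
  with v show False by simp
qed

lemma mink_nonneg_orth_timelike:
  "mink u u < 0 \<Longrightarrow> mink u v = 0 \<Longrightarrow> mink v v \<ge> 0"
  using mink_pos_orth_timelike[of u v] by (cases "v = 0") auto

lemma future_timelike_mink_neg:
  assumes "mink x x < 0" "mink y y < 0" "x $ None > 0" "y $ None > 0"
  shows "mink x y < 0"
proof -
  have "inner (space_part x) (space_part y) \<le> norm (space_part x) * norm (space_part y)"
    by (rule norm_cauchy_schwarz)
  also have "\<dots> < x $ None * y $ None"
    using timelike_norm_less[OF assms(1)] timelike_norm_less[OF assms(2)] assms(3,4)
    by (intro mult_strict_mono') auto
  finally show ?thesis by (simp add: mink_space_part)
qed

lemma mink_orth_insert_iff: "z \<in> mink_orth {a} \<longleftrightarrow> mink a z = 0"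
  by (simp add: mink_orth_def mink_sym)

lemma mink_orth_pair_iff: "z \<in> mink_orth {a, b} \<longleftrightarrow> mink a z = 0 \<and> mink b z = 0"
  by (simp add: mink_orth_def mink_sym)

lemma subspace_mink_orth [simp]: "subspace (mink_orth S)"
  by (auto simp: subspace_def mink_orth_def)

text \<open>Let \<open>J\<close> change the sign of the time coordinate. Since \<open>mink x y = J x \<bullet> y\<close>, the Minkowski
  complement of a set is the Euclidean complement of its image under \<open>J\<close>, and so the dimension
  formula and the double complement theorem carry over from the Euclidean case.\<close>

definition time_flip :: "real ^ ('n::finite) option \<Rightarrow> real ^ 'n option" where
  "time_flip x = x - (2 * x $ None) *\<^sub>R axis None 1"

lemma linear_time_flip: "linear time_flip"
  by (auto intro!: linearI simp: time_flip_def algebra_simps)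

lemma time_flip_time_flip [simp]: "time_flip (time_flip x) = x"
  by (simp add: time_flip_def algebra_simps)

lemma inner_time_flip: "inner (time_flip x) y = mink x y"
  by (simp add: time_flip_def mink_inner inner_diff_left inner_axis')

lemma mink_orth_eq_orthogonal_comp: "mink_orth S = orthogonal_comp (time_flip ` S)"
  by (auto simp: mink_orth_def orthogonal_comp_def orthogonal_def inner_time_flip mink_sym)

lemma time_flip_orthogonal_comp: "time_flip ` orthogonal_comp S = mink_orth S"
proof -
  have "z \<in> time_flip ` orthogonal_comp S \<longleftrightarrow> time_flip z \<in> orthogonal_comp S" for z
    by (metis image_iff time_flip_time_flip)
  moreover have "time_flip z \<in> orthogonal_comp S \<longleftrightarrow> z \<in> mink_orth S" for z
    by (simp add: orthogonal_comp_def orthogonal_def mink_orth_def inner_commute[of _ "time_flip z"]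
        inner_time_flip)
  ultimately show ?thesis by blast
qed

lemma mink_orth_span: "mink_orth (span S) = mink_orth S"
proof
  show "mink_orth S \<subseteq> mink_orth (span S)"
  proof
    fix z assume z: "z \<in> mink_orth S"
    have "mink z y = 0" if "y \<in> span S" for y
      using that
    proof (induction rule: span_induct_alt)
      case base show ?case by simp
    next
      case (step c x y) then show ?case using z by (simp add: mink_orth_def)
    qed
    then show "z \<in> mink_orth (span S)" by (simp add: mink_orth_def)
  qed
qed (auto simp: mink_orth_def span_base)

lemma mink_orth_mink_orth: "mink_orth (mink_orth S) = span S"
proof -
  have "mink_orth (mink_orth S) = orthogonal_comp (time_flip ` time_flip ` orthogonal_comp (span S))"
    by (simp add: mink_orth_eq_orthogonal_comp[of "mink_orth S"] time_flip_orthogonal_comp mink_orth_span)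
  also have "\<dots> = span S"
    by (simp add: image_image orthogonal_comp_self)
  finally show ?thesis .
qed

lemma dim_mink_orth:
  fixes S :: "(real ^ ('n::finite) option) set"
  shows "dim (mink_orth S) + dim S = Suc CARD('n)"
proof -
  have "dim (mink_orth S) = dim (orthogonal_comp (span S))"
  proof -
    have "inj time_flip" by (metis injI time_flip_time_flip)
    then show ?thesis
      unfolding mink_orth_span[of S, symmetric] time_flip_orthogonal_comp[of "span S", symmetric]
      by (intro dim_image_eq linear_time_flip) (auto intro: inj_on_subset)
  qed
  moreover have "dim {y \<in> UNIV. \<forall>x \<in> span S. orthogonal x y} + dim (span S) = dim (UNIV :: (real ^ 'n option) set)"
    by (rule dim_subspace_orthogonal_to_vectors) auto
  ultimately show ?thesis
    by (simp add: orthogonal_comp_def)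
qed

definition hyperbolic_pair :: "real ^ ('n::finite) option \<Rightarrow> real ^ 'n option \<Rightarrow> bool" where
  "hyperbolic_pair a b \<longleftrightarrow> mink a a = -1 \<and> mink b b = 1 \<and> mink a b = 0"

lemma hyperbolic_pairD:
  assumes "hyperbolic_pair a b"
  shows "mink a a = -1" "mink b b = 1" "mink a b = 0" "mink b a = 0"
  using assms by (auto simp: hyperbolic_pair_def mink_sym)

definition pos_def_on :: "(real ^ ('n::finite) option) set \<Rightarrow> bool" where
  "pos_def_on U \<longleftrightarrow> (\<forall>x\<in>U. x \<noteq> 0 \<longrightarrow> mink x x > 0)"

lemma pos_def_onD: "pos_def_on U \<Longrightarrow> x \<in> U \<Longrightarrow> x \<noteq> 0 \<Longrightarrow> mink x x > 0"
  by (simp add: pos_def_on_def)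

lemma pos_def_on_subset: "pos_def_on U \<Longrightarrow> U' \<subseteq> U \<Longrightarrow> pos_def_on U'"
  by (auto simp: pos_def_on_def)

lemma pos_def_on_orth_timelike: "a \<in> S \<Longrightarrow> mink a a < 0 \<Longrightarrow> pos_def_on (mink_orth S)"
  using mink_pos_orth_timelike[of a] by (auto simp: pos_def_on_def mink_orth_def mink_sym)

lemma independent_hyperbolic_pair:
  assumes "hyperbolic_pair a b" shows "dim {a, b} = 2"
proof -
  note p = hyperbolic_pairD[OF assms]
  have "b \<notin> span {a}"
  proof
    assume "b \<in> span {a}"
    then obtain k where "b = k *\<^sub>R a" by (auto simp: span_singleton)
    then show False using p by auto
  qed
  moreover have "a \<noteq> 0" using p by auto
  moreover have "a \<noteq> b" using p by auto
  ultimately have "independent {a, b}"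
    by (metis independent_insert insert_commute dependent_single empty_iff singletonD)
  then show ?thesis
    using \<open>a \<noteq> b\<close> by (simp add: dim_eq_card_independent)
qed

lemma dim_orth_pair:
  fixes a :: "real ^ ('n::finite) option"
  assumes "hyperbolic_pair a b" shows "dim (mink_orth {a, b}) + 1 = CARD('n)"
  using dim_mink_orth[of "{a, b}"] independent_hyperbolic_pair[OF assms] by simp

lemma dim_orth_timelike:
  fixes a :: "real ^ ('n::finite) option"
  assumes "mink a a < 0" shows "dim (mink_orth {a}) = CARD('n)"
proof -
  have "a \<noteq> 0" using assms by auto
  then have "dim {a} = 1" by (simp add: dim_eq_card_independent)
  then show ?thesis using dim_mink_orth[of "{a}"] by simp
qed

definition orth_part :: "real ^ ('n::finite) option \<Rightarrow> real ^ 'n option \<Rightarrow> real ^ 'n option \<Rightarrow> real ^ 'n option"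
  where "orth_part a b z = z + mink a z *\<^sub>R a - mink b z *\<^sub>R b"

lemma orth_part_in:
  assumes "hyperbolic_pair a b" shows "orth_part a b z \<in> mink_orth {a, b}"
  using hyperbolic_pairD[OF assms] by (simp add: mink_orth_pair_iff orth_part_def)

lemma orth_part_decomp: "z = - mink a z *\<^sub>R a + mink b z *\<^sub>R b + orth_part a b z"
  by (simp add: orth_part_def)

section \<open>Isometries and reflections\<close>

lemma invertible_matrix_inv:
  assumes "invertible A"
  shows "A ** matrix_inv A = mat 1" "matrix_inv A ** A = mat 1"
  using assms unfolding invertible_def matrix_inv_def by (metis (mono_tags, lifting) someI_ex)+

lemma matrix_inv_vector_cancel:
  fixes A :: "('m::finite) mat"
  assumes "invertible A"
  shows "A *v (matrix_inv A *v x) = x" "matrix_inv A *v (A *v x) = x"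
  using invertible_matrix_inv[OF assms] by (simp_all add: matrix_vector_mul_assoc)

lemma matrix_inv_unique:
  fixes A :: "('m::finite) mat"
  assumes "A ** B = mat 1" shows "matrix_inv A = B" "invertible A"
proof -
  have "B ** A = mat 1" using assms by (simp add: matrix_left_right_inverse)
  then show "invertible A" using assms by (auto simp: invertible_def)
  then have "matrix_inv A ** (A ** B) = B"
    by (simp add: matrix_mul_assoc invertible_matrix_inv)
  then show "matrix_inv A = B" using assms by simp
qed

lemma scaleR_mat_mult_vec [simp]: "(c *\<^sub>R A) *v x = c *\<^sub>R (A *v x)" for A :: "('m::finite) mat"
  by (simp add: scaleR_matrix_vector_assoc)

lemma neg_mat_mult_vec [simp]: "(- A) *v x = - (A *v x)" for A :: "('m::finite) mat"
  using scaleR_mat_mult_vec[of "-1" A x] by simp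

lemma mat_mult_neg_vec [simp]: "A *v (- x) = - (A *v x)" for A :: "('m::finite) mat"
  using matrix_vector_mult_scaleR[of A "-1" x] by simp

lemmas mat_vec_simps [simp] = matrix_vector_right_distrib matrix_vector_mult_add_rdistrib
  matrix_vector_mult_diff_distrib matrix_vector_mult_diff_rdistrib matrix_vector_mult_scaleR
  matrix_vector_mul_assoc[symmetric]

definition isom :: "('n::finite option) mat \<Rightarrow> bool" where
  "isom A \<longleftrightarrow> (\<forall>x y. mink (A *v x) (A *v y) = mink x y)"

lemma isomD [simp]: "isom A \<Longrightarrow> mink (A *v x) (A *v y) = mink x y"
  by (simp add: isom_def)

lemma isom_mult: "isom A \<Longrightarrow> isom B \<Longrightarrow> isom (A ** B)"
  by (simp add: isom_def)

lemma isom_invertible: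
  assumes "isom A" shows "invertible A"
proof -
  have "x = 0" if "A *v x = 0" for x
    using assms that by (metis isomD mink.zero_left mink_nondegenerate)
  then show ?thesis
    by (simp add: invertible_left_inverse matrix_left_invertible_ker)
qed

lemma isom_inv:
  assumes "isom A" shows "isom (matrix_inv A)"
  unfolding isom_def
  by (metis assms isomD isom_invertible matrix_inv_vector_cancel(1))

lemma isom_inv_mink: "isom A \<Longrightarrow> mink (matrix_inv A *v x) y = mink x (A *v y)"
  by (metis isomD isom_invertible matrix_inv_vector_cancel(1))

text \<open>By the double complement theorem a linear map that fixes \<open>S\<close> fixes \<open>mink_orth (mink_orth S)\<close>, so that the
  groups \<open>SO_of\<close> of the complements of sets are pointwise stabilizers.\<close>

lemma SO_of_orth_iff:
  "A \<in> SO_of (mink_orth S) \<longleftrightarrow> isom A \<and> det A = 1 \<and> (\<forall>x\<in>S. A *v x = x)"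
proof -
  have "A *v x = x" if "\<forall>x\<in>S. A *v x = x" "x \<in> span S" for x
    using that(2)
    by (induction rule: span_induct_alt) (use that(1) in \<open>auto\<close>)
  then show ?thesis
    unfolding SO_of_def mink_orth_mink_orth isom_def by (auto intro: span_base)
qed

lemma SO_of_UNIV_iff: "A \<in> SO_of UNIV \<longleftrightarrow> isom A \<and> det A = 1"
  using SO_of_orth_iff[of A "{}"] by (simp add: mink_orth_def)

lemma SO_ofD:
  assumes "A \<in> SO_of U"
  shows "isom A" "det A = 1" "\<And>x. x \<in> mink_orth U \<Longrightarrow> A *v x = x"
  using assms by (auto simp: SO_of_def isom_def)

lemma SO_ofI:
  "isom A \<Longrightarrow> det A = 1 \<Longrightarrow> (\<And>x. x \<in> mink_orth U \<Longrightarrow> A *v x = x) \<Longrightarrow> A \<in> SO_of U"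
  by (auto simp: SO_of_def isom_def)

lemma SO_of_mono: "U \<subseteq> U' \<Longrightarrow> SO_of U \<subseteq> SO_of U'"
  unfolding SO_of_def mink_orth_def by blast

lemma det_matrix_inv:
  fixes A :: "('m::finite) mat"
  assumes "invertible A" shows "det A * det (matrix_inv A) = 1"
  using invertible_matrix_inv(1)[OF assms] by (metis det_I det_mul)

lemma mat_inv_fix: "invertible A \<Longrightarrow> A *v x = x \<Longrightarrow> matrix_inv A *v x = x" for A :: "('m::finite) mat"
  by (metis matrix_inv_vector_cancel(2))

lemma matrix_group_SO_of: "matrix_group (SO_of U)"
  unfolding matrix_group_def
proof (intro conjI ballI)
  show "mat 1 \<in> SO_of U" by (auto intro!: SO_ofI simp: isom_def)
next
  fix A B assume "A \<in> SO_of U" "B \<in> SO_of U"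
  then show "A ** B \<in> SO_of U"
    by (auto intro!: SO_ofI isom_mult simp: det_mul SO_ofD)
next
  fix A assume A: "A \<in> SO_of U"
  then show "invertible A" by (blast intro: isom_invertible SO_ofD)
  then show "matrix_inv A \<in> SO_of U"
    using SO_ofD[OF A] det_matrix_inv[of A]
    by (auto intro!: SO_ofI isom_inv mat_inv_fix)
qed

lemma SO_of_preserves:
  assumes A: "A \<in> SO_of U" and U: "subspace U" and x: "x \<in> U"
  shows "A *v x \<in> U"
proof -
  have "mink (A *v x) y = 0" if "y \<in> mink_orth U" for y
  proof -
    have "mink (A *v x) y = mink (A *v x) (A *v y)"
      using SO_ofD(3)[OF A that] by simp
    also have "\<dots> = mink x y" using SO_ofD(1)[OF A] by simp
    also have "\<dots> = 0" using that x by (simp add: mink_orth_def mink_sym)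
    finally show ?thesis .
  qed
  then have "A *v x \<in> mink_orth (mink_orth U)" by (simp add: mink_orth_def)
  then show ?thesis using U by (simp add: mink_orth_mink_orth span_eq_iff[THEN iffD2])
qed

text \<open>The rank one endomorphism \<open>x \<otimes> y\<^sup>\<flat>\<close>; bivectors and reflections are both built from it.\<close>

definition outer :: "real ^ ('n::finite) option \<Rightarrow> real ^ 'n option \<Rightarrow> ('n option) mat" where
  "outer x y = matrix (\<lambda>z. mink y z *\<^sub>R x)"

lemma outer_vec [simp]: "outer x y *v z = mink y z *\<^sub>R x"
proof -
  have "linear (\<lambda>z. mink y z *\<^sub>R x)"
    by (auto intro!: linearI simp: algebra_simps)
  then show ?thesis unfolding outer_def by (metis matrix_vector_mul(2))
qed

lemma outer_entry: "outer x y $ i $ j = (if j = None then - (y $ j) else y $ j) * x $ i"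
proof -
  have "outer x y $ i $ j = (outer x y *v axis j 1) $ i"
    by (simp add: matrix_vector_mult_basis column_def del: outer_vec)
  then show ?thesis by (simp add: mink_axis mink_sym[of y "axis j 1"])
qed

lemma bounded_bilinear_outer:
  "bounded_bilinear (outer :: real ^ ('n::finite) option \<Rightarrow> real ^ 'n option \<Rightarrow> _)"
proof -
  have "bilinear (outer :: real ^ ('n::finite) option \<Rightarrow> real ^ 'n option \<Rightarrow> _)"
    unfolding bilinear_def by (auto intro!: linearI simp: vec_eq_iff outer_entry algebra_simps)
  then show ?thesis by (simp add: bilinear_conv_bounded_bilinear)
qed

interpretation outer: bounded_bilinear "outer :: real ^ ('n::finite) option \<Rightarrow> real ^ 'n option \<Rightarrow> _"
  by (rule bounded_bilinear_outer)

lemma bounded_bilinear_mat_mult: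
  "bounded_bilinear ((**) :: ('m::finite) mat \<Rightarrow> 'm mat \<Rightarrow> _)"
proof -
  have "bilinear ((**) :: ('m::finite) mat \<Rightarrow> 'm mat \<Rightarrow> _)"
    unfolding bilinear_def
    by (auto intro!: linearI simp: vec_eq_iff matrix_matrix_mult_def sum.distrib sum_distrib_left algebra_simps)
  then show ?thesis by (simp add: bilinear_conv_bounded_bilinear)
qed

interpretation mat_mult: bounded_bilinear "(**) :: ('m::finite) mat \<Rightarrow> 'm mat \<Rightarrow> _"
  by (rule bounded_bilinear_mat_mult)

lemma bounded_bilinear_mat_vec:
  "bounded_bilinear ((*v) :: ('m::finite) mat \<Rightarrow> real ^ 'm \<Rightarrow> _)"
proof -
  have "bilinear ((*v) :: ('m::finite) mat \<Rightarrow> real ^ 'm \<Rightarrow> _)"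
    unfolding bilinear_def by (auto intro!: linearI)
  then show ?thesis by (simp add: bilinear_conv_bounded_bilinear)
qed

interpretation mat_vec: bounded_bilinear "(*v) :: ('m::finite) mat \<Rightarrow> real ^ 'm \<Rightarrow> _"
  by (rule bounded_bilinear_mat_vec)

definition refl_mat :: "real ^ ('n::finite) option \<Rightarrow> ('n option) mat" where
  "refl_mat u = mat 1 - (2 / mink u u) *\<^sub>R outer u u"

lemma refl_mat_vec [simp]: "refl_mat u *v z = z - (2 * mink u z / mink u u) *\<^sub>R u"
  by (simp add: refl_mat_def)

lemma isom_refl_mat: "isom (refl_mat u)"
  by (cases "mink u u = 0") (auto simp: isom_def mink_sym field_simps)

lemma refl_mat_refl_mat: "refl_mat u ** refl_mat u = mat 1"
  by (cases "mink u u = 0") (auto simp: matrix_eq scaleR_2)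

lemma refl_mat_minus: "refl_mat (- u) = refl_mat u"
  by (simp add: matrix_eq)

lemma isom_conj_refl_mat:
  assumes "isom A" shows "A ** refl_mat u = refl_mat (A *v u) ** A"
  using assms by (simp add: matrix_eq)

text \<open>Reflecting in the difference interchanges two vectors of the same square, and reflecting in
  the sum interchanges them up to sign. One of the two is always available, since the squares of
  the difference and of the sum add up to four times the common square.\<close>

lemma refl_mat_diff_swap:
  assumes "mink u u = mink v v" "mink (u - v) (u - v) \<noteq> 0"
  shows "refl_mat (u - v) *v u = v"
proof -
  have "2 * mink (u - v) u = mink (u - v) (u - v)" using assms(1) by (simp add: mink_sym)
  then have "2 * mink (u - v) u / mink (u - v) (u - v) = 1" using assms(2) by (metis divide_self)
  then show ?thesis by (simp only: refl_mat_vec) simp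
qed

lemma refl_mat_sum_swap:
  assumes "mink u u = mink v v" "mink (u + v) (u + v) \<noteq> 0"
  shows "refl_mat (u + v) *v u = - v"
  using refl_mat_diff_swap[of u "- v"] assms by simp

lemma ex_refl_mat_swap:
  assumes "mink u u = mink v v" "mink u u \<noteq> 0"
  obtains d where "refl_mat d *v u = v \<or> refl_mat d *v u = - v"
proof -
  have "mink (u - v) (u - v) + mink (u + v) (u + v) = 4 * mink u u"
    using assms(1) by simp
  then have "mink (u - v) (u - v) \<noteq> 0 \<or> mink (u + v) (u + v) \<noteq> 0" using assms(2) by auto
  then show thesis using that refl_mat_diff_swap refl_mat_sum_swap assms(1) by metis
qed

text \<open>A reflection is conjugate, by another reflection, to a reflection in a multiple of a coordinate
  vector, and that one is diagonal.\<close>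

lemma det_refl_mat:
  assumes u: "mink u u \<noteq> 0" shows "det (refl_mat u) = -1"
proof -
  define b where "b = (if mink u u < 0 then axis None 1 else axis (Some undefined) 1 :: real ^ 'a option)"
  define v where "v = sqrt \<bar>mink u u\<bar> *\<^sub>R b"
  have bb: "mink b b = sgn (mink u u)"
    using u by (auto simp: b_def mink_axis)
  have vv: "mink v v = mink u u"
  proof -
    have "mink v v = sgn (mink u u) * (sqrt \<bar>mink u u\<bar> * sqrt \<bar>mink u u\<bar>)"
      by (simp add: v_def bb)
    then show ?thesis by (simp add: sgn_mult_abs)
  qed
  obtain i where bi: "b = axis i 1"
    by (cases "mink u u < 0") (simp_all add: b_def)
  obtain d where d: "refl_mat d *v u = v \<or> refl_mat d *v u = - v"
    using ex_refl_mat_swap[of u v] vv u by metis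
  have "refl_mat d ** refl_mat u = refl_mat (refl_mat d *v u) ** refl_mat d"
    by (rule isom_conj_refl_mat[OF isom_refl_mat])
  also have "\<dots> = refl_mat v ** refl_mat d" using d refl_mat_minus[of v] by auto
  finally have "det (refl_mat d) * det (refl_mat u) = det (refl_mat v) * det (refl_mat d)"
    by (metis det_mul)
  moreover have "det (refl_mat d) \<noteq> 0"
    using refl_mat_refl_mat[of d] by (metis det_I det_mul mult_zero_left zero_neq_one)
  ultimately have "det (refl_mat u) = det (refl_mat v)" by simp
  also have "\<dots> = (\<Prod>j\<in>UNIV. refl_mat v $ j $ j)"
  proof (rule det_diagonal)
    fix j k :: "'a option" assume "j \<noteq> k"
    then show "refl_mat v $ j $ k = 0"
      by (auto simp: refl_mat_def mat_def outer_entry v_def bi axis_def)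
  qed
  also have "\<dots> = (\<Prod>j\<in>UNIV. if j = i then -1 else 1)"
  proof (rule prod.cong)
    fix j
    have "(v $ i) * (v $ i) = \<bar>mink u u\<bar>" by (simp add: v_def bi axis_def)
    moreover have "(if i = None then -1 else 1) = sgn (mink u u)"
      using bb by (simp add: bi mink_axis split: if_splits)
    moreover have "(if i = None then - (v $ i) else v $ i) * v $ i
        = (if i = None then -1 else 1) * (v $ i * v $ i)" by simp
    ultimately have "(if i = None then - (v $ i) else v $ i) * v $ i = mink u u"
      by (simp only: sgn_mult_abs)
    then have "refl_mat v $ i $ i = -1"
      using u by (simp add: refl_mat_def mat_def outer_entry vv)
    moreover have "refl_mat v $ j $ j = 1" if "j \<noteq> i"
      using that by (simp add: refl_mat_def mat_def outer_entry v_def bi axis_def)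
    ultimately show "refl_mat v $ j $ j = (if j = i then -1 else 1)" by auto
  qed simp
  also have "\<dots> = -1" by (simp add: prod.delta)
  finally show ?thesis .
qed

lemma refl_mat_mult_in_SO_of:
  assumes "x \<in> U" "y \<in> U" "mink x x \<noteq> 0" "mink y y \<noteq> 0"
  shows "refl_mat x ** refl_mat y \<in> SO_of U"
  using assms
  by (intro SO_ofI isom_mult isom_refl_mat) (auto simp: det_mul det_refl_mat mink_orth_def mink_sym)

text \<open>Sliding one mirror along a segment of nonisotropic vectors connects the product of two
  reflections with the identity. All connectedness statements below rest on this.\<close>

lemma refl_mat_segment:
  assumes U: "subspace U" and x: "x \<in> U" and y: "y \<in> U"
    and seg: "\<And>t. 0 \<le> t \<Longrightarrow> t \<le> 1 \<Longrightarrow> mink ((1 - t) *\<^sub>R x + t *\<^sub>R y) ((1 - t) *\<^sub>R x + t *\<^sub>R y) \<noteq> 0"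
  shows "connected_component (SO_of U) (mat 1) (refl_mat y ** refl_mat x)"
proof -
  define c where "c t = (1 - t) *\<^sub>R x + t *\<^sub>R y" for t :: real
  define f where "f t = refl_mat (c t) ** refl_mat x" for t
  have c: "continuous_on {0..1} c"
    unfolding c_def by (intro continuous_intros)
  have "continuous_on {0..1} f"
    unfolding f_def refl_mat_def
    by (intro mat_mult.continuous_on continuous_intros outer.continuous_on mink.continuous_on c)
      (use seg in \<open>auto simp: c_def\<close>)
  then have "connected (f ` {0..1})"
    by (rule connected_continuous_image) simp
  moreover have "f ` {0..1} \<subseteq> SO_of U"
  proof
    fix A assume "A \<in> f ` {0..1}"
    then obtain t where t: "0 \<le> t" "t \<le> 1" "A = f t" by auto
    have "c t \<in> U" using U x y by (simp add: c_def subspace_add subspace_scale)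
    moreover have "mink x x \<noteq> 0" using seg[of 0] by simp
    ultimately show "A \<in> SO_of U"
      using seg[OF t(1,2)] x by (simp add: t(3) f_def c_def refl_mat_mult_in_SO_of)
  qed
  moreover have "mat 1 \<in> f ` {0..1}"
    by (rule image_eqI[of _ _ 0]) (auto simp: f_def c_def refl_mat_refl_mat)
  moreover have "refl_mat y ** refl_mat x \<in> f ` {0..1}"
    by (rule image_eqI[of _ _ 1]) (auto simp: f_def c_def)
  ultimately show ?thesis unfolding connected_component_def by blast
qed

section \<open>Rotation groups of positive definite subspaces\<close>

lemma matrix_groupD:
  assumes "matrix_group S"
  shows "mat 1 \<in> S" "A \<in> S \<Longrightarrow> B \<in> S \<Longrightarrow> A ** B \<in> S" "A \<in> S \<Longrightarrow> invertible A"
    "A \<in> S \<Longrightarrow> matrix_inv A \<in> S"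
  using assms by (auto simp: matrix_group_def)

text \<open>A left translation by \<open>A\<close> takes the component of the identity to a connected set; if one of its
  elements ends up in the component again, so do all. Taking \<open>X = mat 1\<close> gives products, \<open>X = A\<close>
  and the translation by the inverse of \<open>A\<close> give inverses.\<close>

lemma matrix_group_identity_component:
  assumes S: "matrix_group (S :: ('m::finite) mat set)"
  shows "matrix_group (connected_component_set S (mat 1))"
proof -
  let ?C = "connected_component_set S (mat 1)"
  note gS = matrix_groupD[OF S]
  have one: "mat 1 \<in> ?C" using gS(1) by (simp add: connected_component_refl)
  have sub: "?C \<subseteq> S" by (rule connected_component_subset)
  have trans: "A ** Y \<in> ?C" if A: "A \<in> S" and X: "X \<in> ?C" "A ** X \<in> ?C" and Y: "Y \<in> ?C" for A X Y
  proof -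
    have "continuous_on ?C (\<lambda>B. A ** B)"
      by (rule mat_mult.continuous_on[OF continuous_on_const continuous_on_id])
    then have "connected ((\<lambda>B. A ** B) ` ?C)"
      by (rule connected_continuous_image) (rule connected_connected_component)
    moreover have "(\<lambda>B. A ** B) ` ?C \<subseteq> S" using gS(2)[OF A] sub by auto
    ultimately have "connected_component S (A ** X) (A ** Y)"
      using X(1) Y by (intro connected_componentI[of "(\<lambda>B. A ** B) ` ?C"]) simp_all
    then show ?thesis using X(2) connected_component_trans[of S "mat 1"] by simp
  qed
  show ?thesis
    unfolding matrix_group_def
  proof (intro conjI ballI)
    show "mat 1 \<in> ?C" by (rule one)
  next
    fix A B assume A: "A \<in> ?C" and B: "B \<in> ?C"
    show "A ** B \<in> ?C"
      by (rule trans[of A "mat 1"]) (use A B sub one in auto)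
  next
    fix A assume A: "A \<in> ?C"
    then have "A \<in> S" using sub by blast
    then show inv: "invertible A" by (rule gS(3))
    have "matrix_inv A ** mat 1 \<in> ?C"
      by (rule trans[of "matrix_inv A" A]) (use A sub one gS \<open>A \<in> S\<close> invertible_matrix_inv[OF inv] in auto)
    then show "matrix_inv A \<in> ?C" by simp
  qed
qed

lemma segment_pos_def:
  assumes U: "subspace U" "pos_def_on U" and x: "x \<in> U" and y: "y \<in> U"
    and nz: "\<And>t. 0 \<le> t \<Longrightarrow> t \<le> 1 \<Longrightarrow> (1 - t) *\<^sub>R x + t *\<^sub>R y \<noteq> 0"
  shows "connected_component (SO_of U) (mat 1) (refl_mat y ** refl_mat x)"
proof (rule refl_mat_segment[OF U(1) x y])
  fix t :: real assume t: "0 \<le> t" "t \<le> 1"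
  have "(1 - t) *\<^sub>R x + t *\<^sub>R y \<in> U" using U x y by (simp add: subspace_add subspace_scale)
  then show "mink ((1 - t) *\<^sub>R x + t *\<^sub>R y) ((1 - t) *\<^sub>R x + t *\<^sub>R y) \<noteq> 0"
    using pos_def_onD[OF U(2)] nz[OF t] by force
qed

text \<open>The rotation that takes \<open>x\<close> to \<open>y\<close> is the product of the reflections in \<open>x\<close> and in
  \<open>x + y\<close>, and it lies in the identity component because the segment from \<open>x\<close> to \<open>x + y\<close>
  avoids the origin.\<close>

lemma rotation_not_antipodal:
  assumes U: "subspace U" "pos_def_on U" and x: "x \<in> U" and y: "y \<in> U"
    and eq: "mink x x = mink y y" and ne: "y \<noteq> - x"
  shows "connected_component (SO_of U) (mat 1) (refl_mat (x + y) ** refl_mat x)"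
    "refl_mat (x + y) *v (refl_mat x *v x) = y"
proof -
  have x0: "x \<noteq> 0"
    using ne eq pos_def_onD[OF U(2) y] by auto
  then have xx: "mink x x > 0" using pos_def_onD[OF U(2) x] by simp
  show "connected_component (SO_of U) (mat 1) (refl_mat (x + y) ** refl_mat x)"
  proof (rule segment_pos_def[OF U x])
    show "x + y \<in> U" using U x y by (simp add: subspace_add)
    fix t :: real assume t: "0 \<le> t" "t \<le> 1"
    have seg: "(1 - t) *\<^sub>R x + t *\<^sub>R (x + y) = x + t *\<^sub>R y" by (simp add: algebra_simps)
    show "(1 - t) *\<^sub>R x + t *\<^sub>R (x + y) \<noteq> 0"
    proof
      assume "(1 - t) *\<^sub>R x + t *\<^sub>R (x + y) = 0"
      then have xt: "x = - (t *\<^sub>R y)" unfolding seg by (simp add: add_eq_0_iff2)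
      then have "mink x x = t\<^sup>2 * mink y y" by (simp add: power2_eq_square)
      then have "mink x x = t\<^sup>2 * mink x x" unfolding eq .
      then have "t = 1" using xx t by (auto simp: power2_eq_1_iff)
      then show False using xt ne by simp
    qed
  qed
  have "x + y \<noteq> 0" using ne by (metis add.commute eq_neg_iff_add_eq_0)
  then have "mink (x + y) (x + y) > 0"
    using pos_def_onD[OF U(2)] U x y by (simp add: subspace_add del: mink_simps)
  then have "refl_mat (x + y) *v x = - y"
    by (intro refl_mat_sum_swap eq) simp
  moreover have "refl_mat x *v x = - x" using xx by (simp add: scaleR_2)
  ultimately show "refl_mat (x + y) *v (refl_mat x *v x) = y"
    by (simp del: refl_mat_vec)
qed

lemma ex_orthogonal_in:
  assumes U: "subspace U" "pos_def_on U" "2 \<le> dim U" and x: "x \<in> U"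
  obtains z where "z \<in> U" "z \<noteq> 0" "mink x z = 0"
proof -
  have "\<not> U \<subseteq> span {x}"
  proof
    assume "U \<subseteq> span {x}"
    then have "dim U \<le> dim {x}" by (metis dim_span dim_subset)
    also have "dim {x} \<le> 1" using dim_le_card[of "{x}" "{x}"] by (simp add: span_base)
    finally show False using U by simp
  qed
  then obtain v where v: "v \<in> U" "v \<notin> span {x}" by auto
  define z where "z = v - (mink x v / mink x x) *\<^sub>R x"
  have "z \<noteq> 0"
  proof
    assume "z = 0"
    then have "v = (mink x v / mink x x) *\<^sub>R x" by (simp add: z_def)
    then show False using v by (metis span_singleton rangeI)
  qed
  moreover have "z \<in> U" using U x v by (simp add: z_def subspace_diff subspace_scale)
  moreover have "mink x z = 0"
    using pos_def_onD[OF U(2) x] by (cases "x = 0") (auto simp: z_def)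
  ultimately show thesis using that by blast
qed

text \<open>For antipodal \<open>x\<close> and \<open>y\<close> a second mirror orthogonal to \<open>x\<close> is used; this is where the
  dimension must be at least two.\<close>

lemma rotation_transitive:
  assumes U: "subspace U" "pos_def_on U" "2 \<le> dim U" and x: "x \<in> U" and y: "y \<in> U"
    and eq: "mink x x = mink y y"
  obtains A where "connected_component (SO_of U) (mat 1) A" "A *v x = y"
proof (cases "y = - x")
  case False
  then show thesis
    using rotation_not_antipodal[OF U(1,2) x y eq] that
    by (metis matrix_vector_mul_assoc)
next
  case True
  show thesis
  proof (cases "x = 0")
    case True
    have "connected_component (SO_of U) (mat 1) (mat 1)"
      using matrix_groupD(1)[OF matrix_group_SO_of] by (simp add: connected_component_refl)
    then show thesis by (rule that) (simp add: True \<open>y = - x\<close>)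
  next
    case False
    obtain z where z: "z \<in> U" "z \<noteq> 0" "mink x z = 0" using ex_orthogonal_in[OF U x] .
    have pos: "mink x x > 0" "mink z z > 0" using pos_def_onD[OF U(2)] x z False by auto
    have "connected_component (SO_of U) (mat 1) (refl_mat z ** refl_mat x)"
    proof (rule segment_pos_def[OF U(1,2) x z(1)])
      fix t :: real assume t: "0 \<le> t" "t \<le> 1"
      show "(1 - t) *\<^sub>R x + t *\<^sub>R z \<noteq> 0"
      proof
        assume *: "(1 - t) *\<^sub>R x + t *\<^sub>R z = 0"
        have "(1 - t) * mink x x = mink x ((1 - t) *\<^sub>R x + t *\<^sub>R z)" using z(3) by simp
        then have "t = 1" using * pos by simp
        then show False using * z(2) by simp
      qed
    qed
    moreover have "(refl_mat z ** refl_mat x) *v x = - x"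
      using pos z(3) by (simp add: mink_sym scaleR_2)
    ultimately show thesis using that True by simp
  qed
qed

lemma subspace_dim_le_1_span:
  fixes U :: "'a::euclidean_space set"
  assumes "subspace U" "dim U \<le> 1"
  obtains w where "U = span {w}"
proof -
  obtain B where B: "B \<subseteq> U" "independent B" "U \<subseteq> span B" "card B = dim U"
    by (rule basis_exists)
  then have sp: "U = span B" using assms(1) by (metis span_subspace)
  have "finite B" using B(2) by (rule independent_imp_finite)
  then have "B = {} \<or> (\<exists>w. B = {w})"
    using B(4) assms(2) by (metis One_nat_def card_0_eq card_1_singletonE le_Suc_eq le_zero_eq)
  then show thesis using that[of 0] that sp by auto
qed

text \<open>In a line the only orthogonal maps are \<open>\<plusminus>1\<close>, and \<open>-1\<close> is a reflection, of determinant \<open>-1\<close>.\<close>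

lemma SO_of_dim_le_1:
  assumes U: "subspace U" "pos_def_on U" "dim U \<le> 1"
  shows "SO_of U = {mat 1}"
proof -
  have "A = mat 1" if A: "A \<in> SO_of U" for A
  proof -
    obtain w where w: "U = span {w}" using subspace_dim_le_1_span[OF U(1,3)] .
    have wU: "w \<in> U" by (simp add: w span_base)
    have split: "\<exists>a y. z = a *\<^sub>R w + y \<and> y \<in> mink_orth U" for z
    proof (intro exI conjI)
      show "z = (mink w z / mink w w) *\<^sub>R w + (z - (mink w z / mink w w) *\<^sub>R w)" by simp
      have "mink w (z - (mink w z / mink w w) *\<^sub>R w) = 0"
        using pos_def_onD[OF U(2) wU] by (cases "w = 0") auto
      then show "z - (mink w z / mink w w) *\<^sub>R w \<in> mink_orth U"
        unfolding w mink_orth_span mink_orth_insert_iff .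
    qed
    obtain c where c: "A *v w = c *\<^sub>R w"
      using SO_of_preserves[OF A U(1) wU] unfolding w by (auto simp: span_singleton)
    show ?thesis
    proof (cases "w = 0")
      case True
      then have "A *v z = z" for z
        using split[of z] SO_ofD(3)[OF A] by auto
      then show ?thesis by (simp add: matrix_eq)
    next
      case False
      then have ww: "mink w w > 0" using pos_def_onD[OF U(2) wU] by simp
      have "mink w w = c * c * mink w w"
        using isomD[OF SO_ofD(1)[OF A], of w w] by (simp add: c)
      then have "c\<^sup>2 = 1" using ww by (simp add: power2_eq_square)
      then have "c = 1 \<or> c = - 1" by (simp add: power2_eq_1_iff)
      moreover have "c \<noteq> -1"
      proof
        assume "c = -1"
        \<comment> \<open>the two maps agree on the line and on its complement\<close>
        have "A *v z = refl_mat w *v z" for z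
        proof -
          obtain a y where ay: "z = a *\<^sub>R w + y" "y \<in> mink_orth U" using split[of z] by blast
          then have "mink w y = 0" using wU by (auto simp: mink_orth_def mink_sym)
          then show ?thesis using ay SO_ofD(3)[OF A ay(2)] ww c \<open>c = -1\<close>
            by (simp add: scaleR_2)
        qed
        then have "A = refl_mat w" by (simp add: matrix_eq del: refl_mat_vec)
        then show False using det_refl_mat[of w] ww SO_ofD(2)[OF A] by simp
      qed
      ultimately have "c = 1" by simp
      then have "A *v z = z" for z
        using split[of z] SO_ofD(3)[OF A] c by auto
      then show ?thesis by (simp add: matrix_eq)
    qed
  qed
  then show ?thesis using matrix_groupD(1)[OF matrix_group_SO_of] by blast
qed

text \<open>Induction on the dimension: after a rotation in the identity component, a given element fixes a
  vector of \<open>U\<close> and so belongs to the group of the complement of that vector.\<close>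

lemma SO_of_component:
  assumes "subspace U" "pos_def_on U" "A \<in> SO_of U"
  shows "connected_component (SO_of U) (mat 1) A"
  using assms
proof (induction "dim U" arbitrary: U A rule: less_induct)
  case less
  note U = less.prems(1,2) and A = less.prems(3)
  let ?C = "connected_component_set (SO_of U) (mat 1)"
  have grp: "matrix_group ?C"
    by (intro matrix_group_identity_component matrix_group_SO_of)
  show ?case
  proof (cases "dim U \<le> 1")
    case True
    then show ?thesis
      using SO_of_dim_le_1[OF U True] A by (auto simp: connected_component_refl)
  next
    case False
    then have d: "2 \<le> dim U" by simp
    then obtain w where w: "w \<in> U" "w \<noteq> 0"
      using ex_orthogonal_in[OF U d subspace_0[OF U(1)]] by blast
    have ww: "mink w w > 0" using pos_def_onD[OF U(2)] w by simp
    have AwU: "A *v w \<in> U" by (rule SO_of_preserves[OF A U(1) w(1)])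
    obtain B where B: "B \<in> ?C" "B *v (A *v w) = w"
      using rotation_transitive[OF U d AwU w(1)] SO_ofD(1)[OF A] by (metis isomD mem_Collect_eq)
    have BS: "B \<in> SO_of U" using B(1) connected_component_subset by blast
    define U' where "U' = U \<inter> mink_orth {w}"
    have U': "subspace U'" "U' \<subseteq> U" using U by (auto simp: U'_def subspace_inter)
    have "w \<notin> U'" using ww by (simp add: U'_def mink_orth_insert_iff)
    then have "U' \<subset> U" using U'(2) w by blast
    then have "dim U' < dim U"
      by (metis U'(1) U(1) dim_psubset span_eq_iff)
    moreover have "B ** A \<in> SO_of U'"
    proof (rule SO_ofI)
      show "isom (B ** A)" using BS A by (simp add: isom_mult SO_ofD)
      show "det (B ** A) = 1" using BS A by (simp add: det_mul SO_ofD)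
      fix z assume z: "z \<in> mink_orth U'"
      define y where "y = z - (mink w z / mink w w) *\<^sub>R w"
      have wy: "mink w y = 0" using ww by (simp add: y_def)
      have "mink y u = 0" if "u \<in> U" for u
      proof -
        define u' where "u' = u - (mink w u / mink w w) *\<^sub>R w"
        have "u' \<in> U'"
          using that U w ww by (simp add: U'_def u'_def subspace_diff subspace_scale mink_orth_insert_iff)
        then have "mink z u' = 0" "mink w u' = 0"
          using z ww by (auto simp: mink_orth_def U'_def mink_sym)
        then have "mink y u' = 0" by (simp add: y_def)
        moreover have "mink y u = mink y u'" using wy by (simp add: u'_def mink_sym)
        ultimately show ?thesis by simp
      qed
      then have "y \<in> mink_orth U" by (simp add: mink_orth_def)
      then have "(B ** A) *v y = y" using BS A by (simp add: SO_ofD)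
      moreover have "z = y + (mink w z / mink w w) *\<^sub>R w" by (simp add: y_def)
      moreover have "(B ** A) *v w = w" using B by simp
      ultimately show "(B ** A) *v z = z"
        by (metis matrix_vector_right_distrib matrix_vector_mult_scaleR)
    qed
    ultimately have "connected_component (SO_of U') (mat 1) (B ** A)"
      using less.hyps U' pos_def_on_subset[OF U(2)] by blast
    then have BA: "B ** A \<in> ?C"
      using connected_component_of_subset[OF _ SO_of_mono[OF U'(2)]] by simp
    have "matrix_inv B ** (B ** A) \<in> ?C"
      using matrix_groupD[OF grp] B(1) BA by blast
    then show ?thesis
      using invertible_matrix_inv(2)[OF matrix_groupD(3)[OF grp B(1)]] by (simp add: matrix_mul_assoc)
  qed
qed

lemma connected_SO_of:
  assumes "subspace U" "pos_def_on U" shows "connected (SO_of U)"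
proof -
  have "SO_of U = connected_component_set (SO_of U) (mat 1)"
    using SO_of_component[OF assms] connected_component_subset by fastforce
  then show ?thesis using connected_connected_component[of "SO_of U" "mat 1"] by simp
qed

lemma SO_of_transitive:
  assumes "subspace U" "pos_def_on U" "2 \<le> dim U" "x \<in> U" "y \<in> U" "mink x x = mink y y"
  obtains A where "A \<in> SO_of U" "A *v x = y"
  using rotation_transitive[OF assms] connected_component_subset by (metis mem_Collect_eq subset_iff)

lemma SO_of_neg:
  assumes "subspace U" "pos_def_on U" "2 \<le> dim U" "x \<in> U"
  obtains A where "A \<in> SO_of U" "A *v x = - x"
  using SO_of_transitive[OF assms, of "- x"] assms by (auto simp: subspace_neg)

text \<open>An isometry that fixes a unit timelike vector \<open>f\<close> preserves the positive definite quadratic form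
  \<open>mink z z + 2 (mink f z)\<^sup>2\<close>. This is the squared Euclidean norm of \<open>z\<close> seen through a
  reflection that takes \<open>f\<close> to the time axis.\<close>

lemma isom_fix_timelike_bounded:
  assumes f: "mink f f = -1"
  obtains C where "\<And>A z. isom A \<Longrightarrow> A *v f = f \<Longrightarrow> norm (A *v z) \<le> C * norm z"
proof -
  define t where "t = (axis None 1 :: real ^ 'a option)"
  have tt: "mink t t = -1" by (simp add: t_def mink_axis)
  obtain d where d: "refl_mat d *v f = t \<or> refl_mat d *v f = - t"
    using ex_refl_mat_swap[of f t] f tt by (metis neg_equal_0_iff_equal zero_neq_one)
  define R where "R = refl_mat d"
  have iso: "isom R" by (simp add: R_def isom_refl_mat)
  have RR: "R *v (R *v z) = z" for z
    unfolding R_def matrix_vector_mul_assoc refl_mat_refl_mat by simp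
  have nrm: "(norm (R *v z))\<^sup>2 = mink z z + 2 * (mink f z)\<^sup>2" for z
  proof -
    have "mink f z = mink (R *v f) (R *v z)" using iso by simp
    then have "(mink f z)\<^sup>2 = (mink t (R *v z))\<^sup>2" using d by (auto simp: R_def simp del: refl_mat_vec)
    also have "\<dots> = (R *v z) $ None * (R *v z) $ None"
      by (simp add: t_def mink_axis power2_eq_square)
    finally have "mink z z + 2 * (mink f z)\<^sup>2 = mink (R *v z) (R *v z) + 2 * ((R *v z) $ None * (R *v z) $ None)"
      using iso by simp
    also have "\<dots> = (norm (R *v z))\<^sup>2" by (simp add: mink_inner power2_norm_eq_inner)
    finally show ?thesis by simp
  qed
  have pres: "norm (R *v (A *v z)) = norm (R *v z)" if "isom A" "A *v f = f" for A z
  proof -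
    have "mink f (A *v z) = mink f z" using that by (metis isomD)
    then have "(norm (R *v (A *v z)))\<^sup>2 = (norm (R *v z))\<^sup>2" unfolding nrm using that by simp
    then show ?thesis by simp
  qed
  define C where "C = onorm ((*v) R)"
  have C: "norm (R *v z) \<le> C * norm z" for z unfolding C_def by (rule onorm) simp
  show thesis
  proof
    fix A z assume A: "isom A" "A *v f = f"
    have "norm (A *v z) \<le> C * norm (R *v (A *v z))" using C[of "R *v (A *v z)"] by (simp add: RR)
    also have "\<dots> = C * norm (R *v z)" using pres[OF A] by simp
    also have "\<dots> \<le> C * (C * norm z)" using C by (intro mult_left_mono) (auto simp: C_def onorm_pos_le)
    finally show "norm (A *v z) \<le> (C * C) * norm z" by (simp add: mult.assoc)
  qed
qed

lemma bounded_matrices: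
  fixes S :: "('m::finite) mat set"
  assumes "\<And>A z. A \<in> S \<Longrightarrow> norm (A *v z) \<le> C * norm z"
  shows "bounded S"
proof -
  have "norm A \<le> (\<Sum>i\<in>(UNIV::'m set). \<Sum>j\<in>(UNIV::'m set). C)" if "A \<in> S" for A
  proof -
    have entry: "\<bar>A $ i $ j\<bar> \<le> C" for i j
    proof -
      have "A $ i $ j = (A *v axis j 1) $ i" by (simp add: matrix_vector_mult_basis column_def)
      then have "\<bar>A $ i $ j\<bar> \<le> norm (A *v axis j 1)" using component_le_norm_cart by metis
      also have "\<dots> \<le> C" using assms[OF that, of "axis j 1"] by simp
      finally show ?thesis .
    qed
    have "norm A \<le> (\<Sum>i\<in>UNIV. norm (A $ i))" unfolding norm_vec_def by (rule L2_set_le_sum) simp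
    also have "\<dots> \<le> (\<Sum>i\<in>UNIV. \<Sum>j\<in>UNIV. \<bar>A $ i $ j\<bar>)" by (intro sum_mono norm_le_l1_cart)
    also have "\<dots> \<le> (\<Sum>i\<in>(UNIV::'m set). \<Sum>j\<in>(UNIV::'m set). C)" by (intro sum_mono entry)
    finally show ?thesis .
  qed
  then show ?thesis by (auto simp: bounded_iff)
qed

lemma closed_SO_of: "closed (SO_of U)"
proof -
  have "SO_of U = (\<Inter>x. \<Inter>y. {A. mink (A *v x) (A *v y) = mink x y}) \<inter> {A. det A = 1}
      \<inter> (\<Inter>x\<in>mink_orth U. {A. A *v x = x})"
    by (auto simp: SO_of_def)
  moreover have "continuous_on UNIV (\<lambda>A::('a option) mat. det A)"
    unfolding det_def by (intro continuous_intros)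
  ultimately show ?thesis
    by (auto intro!: closed_Int closed_INT closed_Collect_eq mink.continuous_on mat_vec.continuous_on
        continuous_intros)
qed

lemma compact_SO_of:
  assumes "f \<in> mink_orth U" "mink f f = -1" shows "compact (SO_of U)"
proof -
  obtain C where C: "\<And>A z. isom A \<Longrightarrow> A *v f = f \<Longrightarrow> norm (A *v z) \<le> C * norm z"
    using isom_fix_timelike_bounded[OF assms(2)] by blast
  have "bounded (SO_of U)"
    by (rule bounded_matrices[of _ C]) (use C assms(1) in \<open>auto dest: SO_ofD\<close>)
  then show ?thesis using closed_SO_of compact_eq_bounded_closed by blast
qed

section \<open>The identity component of the Lorentz group\<close>

lemma matrix_group_SO0: "matrix_group SO0_1n"
  unfolding SO0_1n_def by (intro matrix_group_identity_component matrix_group_SO_of)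

lemma SO0_subset: "SO0_1n \<subseteq> SO_of UNIV"
  unfolding SO0_1n_def by (rule connected_component_subset)

lemma SO0_isom: "g \<in> SO0_1n \<Longrightarrow> isom g"
  using SO0_subset SO_ofD(1) by blast

lemma SO_of_component_SO0:
  assumes "connected_component (SO_of U) (mat 1) A" shows "A \<in> SO0_1n"
  using connected_component_of_subset[OF assms SO_of_mono[of U UNIV]] by (simp add: SO0_1n_def)

lemma SO_of_subset_SO0:
  assumes "subspace U" "pos_def_on U" shows "SO_of U \<subseteq> SO0_1n"
  using SO_of_component[OF assms] SO_of_component_SO0 by blast

lemma pos_def_on_orth_pair:
  assumes "hyperbolic_pair a b" shows "pos_def_on (mink_orth {a, b})"
  using hyperbolic_pairD(1)[OF assms] by (intro pos_def_on_orth_timelike[of a]) auto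

lemma compact_connected_SO_of:
  assumes "a \<in> S" "mink a a = -1"
  shows "compact_connected_subgroup SO0_1n (SO_of (mink_orth S))"
proof -
  have pos: "pos_def_on (mink_orth S)"
    using assms by (intro pos_def_on_orth_timelike[of a]) auto
  have "a \<in> mink_orth (mink_orth S)" using assms by (simp add: mink_orth_mink_orth span_base)
  then show ?thesis
    unfolding compact_connected_subgroup_def
    using matrix_group_SO_of connected_SO_of[OF _ pos] SO_of_subset_SO0[OF _ pos] compact_SO_of[OF _ assms(2)]
    by simp
qed

lemma SO_of_conj:
  assumes g: "isom g"
  shows "(\<lambda>h. g ** h ** matrix_inv g) ` SO_of (mink_orth S) = SO_of (mink_orth ((*v) g ` S))"
proof -
  note inv = invertible_matrix_inv[OF isom_invertible[OF g]]
  have into: "f ** h ** matrix_inv f \<in> SO_of (mink_orth ((*v) f ` T))"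
    if f: "isom f" and h: "h \<in> SO_of (mink_orth T)" for f h :: "('a option) mat" and T
  proof -
    have "det (f ** h ** matrix_inv f) = det f * det (matrix_inv f) * det h"
      by (simp add: det_mul)
    also have "\<dots> = 1"
      using h det_matrix_inv[OF isom_invertible[OF f]] by (simp add: SO_ofD)
    finally have "det (f ** h ** matrix_inv f) = 1" .
    then show ?thesis
      using h f by (auto simp: SO_of_orth_iff isom_mult isom_inv matrix_inv_vector_cancel isom_invertible)
  qed
  show ?thesis
  proof
    show "SO_of (mink_orth ((*v) g ` S)) \<subseteq> (\<lambda>h. g ** h ** matrix_inv g) ` SO_of (mink_orth S)"
    proof
      fix k assume k: "k \<in> SO_of (mink_orth ((*v) g ` S))"
      have "matrix_inv (matrix_inv g) = g" by (rule matrix_inv_unique[OF inv(2)])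
      moreover have "(*v) (matrix_inv g) ` (*v) g ` S = S"
        by (simp add: image_image matrix_inv_vector_cancel isom_invertible g)
      ultimately have "matrix_inv g ** k ** g \<in> SO_of (mink_orth S)"
        using into[OF isom_inv[OF g] k] by simp
      moreover have "g ** (matrix_inv g ** k ** g) ** matrix_inv g = (g ** matrix_inv g) ** k ** (g ** matrix_inv g)"
        by (simp only: matrix_mul_assoc)
      then have "g ** (matrix_inv g ** k ** g) ** matrix_inv g = k"
        by (simp add: inv)
      ultimately show "k \<in> (\<lambda>h. g ** h ** matrix_inv g) ` SO_of (mink_orth S)"
        by (metis image_eqI)
    qed
  qed (use into[OF g] in blast)
qed

lemma hyperbolic_pair_isom: "isom g \<Longrightarrow> hyperbolic_pair a b \<Longrightarrow> hyperbolic_pair (g *v a) (g *v b)"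
  by (simp add: hyperbolic_pair_def)

text \<open>Two reflections in timelike vectors match the timelike members, and a rotation of their complement
  then matches the spacelike ones. The sign is unavoidable, because the identity component does not
  exchange future and past.\<close>

lemma SO0_transitive_pairs:
  fixes a b a' b' :: "real ^ ('n::finite) option"
  assumes n: "CARD('n) \<ge> 2" and p: "hyperbolic_pair a b" "hyperbolic_pair a' b'"
  obtains g where "g \<in> SO0_1n" "g *v a = a' \<or> g *v a = - a'" "g *v b = b'"
proof -
  note a = hyperbolic_pairD[OF p(1)] and a' = hyperbolic_pairD[OF p(2)]
  have "a' \<noteq> 0" using a'(1) by auto
  then have "mink a a' \<noteq> 0" using mink_pos_orth_timelike[of a a'] a(1) a'(1) by auto
  define c where "c = (if mink a a' < 0 then a' else - a')"
  have cc: "mink c c = -1" and ac: "mink a c < 0" using a' \<open>mink a a' \<noteq> 0\<close> by (auto simp: c_def)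
  define g0 where "g0 = refl_mat (a + c) ** refl_mat a"
  have "connected_component (SO_of UNIV) (mat 1) g0"
    unfolding g0_def
  proof (rule refl_mat_segment)
    fix t :: real assume t: "0 \<le> t" "t \<le> 1"
    have "mink ((1 - t) *\<^sub>R a + t *\<^sub>R (a + c)) ((1 - t) *\<^sub>R a + t *\<^sub>R (a + c)) = -1 - t\<^sup>2 + 2 * t * mink a c"
      using a cc by (simp add: mink_sym[of c a] algebra_simps power2_eq_square)
    moreover have "t * mink a c \<le> 0" using t ac by (simp add: mult_le_0_iff)
    moreover have "0 \<le> t\<^sup>2" by simp
    ultimately show "mink ((1 - t) *\<^sub>R a + t *\<^sub>R (a + c)) ((1 - t) *\<^sub>R a + t *\<^sub>R (a + c)) \<noteq> 0" by linarith
  qed auto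
  then have g0: "g0 \<in> SO0_1n" by (simp add: SO0_1n_def)
  have "mink (a + c) (a + c) \<noteq> 0" using a cc ac by (simp add: mink_sym[of c a])
  then have "refl_mat (a + c) *v a = - c" using a cc by (intro refl_mat_sum_swap) auto
  moreover have "refl_mat a *v a = - a" using a by (simp add: scaleR_2)
  ultimately have g0a: "g0 *v a = c" by (simp add: g0_def del: refl_mat_vec)
  note iso0 = SO0_isom[OF g0]
  have "mink c c < 0" using cc by simp
  then have U: "pos_def_on (mink_orth {c})" "2 \<le> dim (mink_orth {c})"
    using n by (auto intro: pos_def_on_orth_timelike simp: dim_orth_timelike)
  have b: "g0 *v b \<in> mink_orth {c}" "b' \<in> mink_orth {c}"
    using iso0 a a' by (auto simp: mink_orth_insert_iff g0a[symmetric]) (simp add: g0a c_def)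
  have "mink (g0 *v b) (g0 *v b) = mink b' b'" using iso0 a a' by simp
  then obtain g1 where g1: "g1 \<in> SO_of (mink_orth {c})" "g1 *v (g0 *v b) = b'"
    using SO_of_transitive[OF _ U b] by auto
  have "g1 *v c = c" using g1(1) by (simp add: SO_of_orth_iff)
  then have "(g1 ** g0) *v a = a' \<or> (g1 ** g0) *v a = - a'" by (auto simp: g0a c_def)
  moreover have "g1 ** g0 \<in> SO0_1n"
    using SO_of_subset_SO0[OF _ U(1)] g1(1) g0 matrix_groupD(2)[OF matrix_group_SO0] by auto
  ultimately show thesis using that[of "g1 ** g0"] g1(2) by simp
qed

section \<open>Compact subgroups fix a timelike vector\<close>

text \<open>The time component of the image of the unit vector on the time axis never vanishes, so its sign
  is constant on the identity component.\<close>

lemma SO0_future: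
  assumes A: "A \<in> (SO0_1n :: (('n::finite) option) mat set)"
  shows "(A *v axis None 1) $ None > 0"
proof -
  define f where "f B = (B *v axis None 1) $ None" for B :: "('n option) mat"
  have "continuous_on SO0_1n f"
    unfolding f_def
    by (intro continuous_on_component mat_vec.continuous_on[OF continuous_on_id continuous_on_const])
  moreover have "connected (SO0_1n :: ('n option) mat set)" unfolding SO0_1n_def by simp
  ultimately have "connected (f ` SO0_1n)" by (rule connected_continuous_image)
  then have int: "is_interval (f ` SO0_1n)" by (simp add: is_interval_connected_1)
  have "f B \<noteq> 0" if B: "B \<in> SO0_1n" for B
  proof
    assume "f B = 0"
    then have "mink (B *v axis None 1) (B *v axis None 1) \<ge> 0"
      by (simp add: mink_space_part f_def)
    moreover have "mink (B *v axis None 1) (B *v axis None 1) = -1"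
      using SO0_isom[OF B] by (simp add: mink_axis)
    ultimately show False by simp
  qed
  then have "0 \<notin> f ` SO0_1n" by (metis imageE)
  moreover have "f (mat 1) = 1" by (simp add: f_def)
  then have "1 \<in> f ` SO0_1n" by (metis imageI matrix_groupD(1) matrix_group_SO0)
  ultimately have "\<not> f A \<le> 0"
    using mem_is_interval_1_I[OF int, of "f A" 1 0] A by auto
  then show ?thesis by (simp add: f_def)
qed

lemma convex_future_cone: "convex {x. x $ None > 0 \<and> mink x x < 0}"
proof (rule convexI)
  fix x y :: "real ^ 'a option" and u v :: real
  assume x: "x \<in> {x. x $ None > 0 \<and> mink x x < 0}" and y: "y \<in> {x. x $ None > 0 \<and> mink x x < 0}"
    and u: "0 \<le> u" and v: "0 \<le> v" and uv: "u + v = 1"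
  have xy: "mink x y < 0" using future_timelike_mink_neg[of x y] x y by simp
  have e: "mink (u *\<^sub>R x + v *\<^sub>R y) (u *\<^sub>R x + v *\<^sub>R y)
      = u\<^sup>2 * mink x x + 2 * (u * v) * mink x y + v\<^sup>2 * mink y y"
    by (simp add: mink_sym[of y x] power2_eq_square algebra_simps)
  show "u *\<^sub>R x + v *\<^sub>R y \<in> {x. x $ None > 0 \<and> mink x x < 0}"
  proof (cases "u = 0")
    case True then show ?thesis using y uv by simp
  next
    case False
    then have "u > 0" using u by simp
    have "u\<^sup>2 * mink x x < 0" using x \<open>u > 0\<close> by (simp add: mult_less_0_iff)
    moreover have "2 * (u * v) * mink x y \<le> 0" using xy u v by (simp add: mult_le_0_iff)
    moreover have "v\<^sup>2 * mink y y \<le> 0" using y by (simp add: mult_le_0_iff)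
    ultimately have "mink (u *\<^sub>R x + v *\<^sub>R y) (u *\<^sub>R x + v *\<^sub>R y) < 0" unfolding e by linarith
    moreover have "u * x $ None > 0" "v * y $ None \<ge> 0" using x y \<open>u > 0\<close> v by auto
    ultimately show ?thesis by simp
  qed
qed

text \<open>Minimize \<open>mink x x\<close> over the convex hull of an orbit of \<open>K\<close> in the
  future cone. Two minimizers \<open>x\<close>, \<open>y\<close> coincide, because \<open>x - y\<close> is orthogonal to the timelike
  vector \<open>x + y\<close>, hence spacelike, and so the midpoint would do better. The unique minimizer
  is fixed by \<open>K\<close>.\<close>

lemma compact_subgroup_fixes_timelike:
  fixes K :: "(('n::finite) option) mat set"
  assumes K: "matrix_group K" "K \<subseteq> SO0_1n" "compact K"
  obtains f where "mink f f = -1" "\<And>k. k \<in> K \<Longrightarrow> k *v f = f"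
proof -
  define t where "t = (axis None 1 :: real ^ 'n option)"
  define O' where "O' = (\<lambda>k. k *v t) ` K"
  define C where "C = convex hull O'"
  let ?F = "{x :: real ^ 'n option. x $ None > 0 \<and> mink x x < 0}"
  note gK = matrix_groupD[OF K(1)]
  have "compact O'"
    unfolding O'_def
    by (intro compact_continuous_image mat_vec.continuous_on[OF continuous_on_id continuous_on_const] K)
  then have "compact C" unfolding C_def by (rule compact_convex_hull)
  moreover have "C \<noteq> {}" using gK(1) by (auto simp: C_def O'_def)
  moreover have "continuous_on C (\<lambda>x. mink x x)"
    by (intro mink.continuous_on continuous_on_id)
  ultimately obtain x where x: "x \<in> C" "\<And>y. y \<in> C \<Longrightarrow> mink x x \<le> mink y y"
    using continuous_attains_inf[of C "\<lambda>x. mink x x"] by metis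
  have "O' \<subseteq> ?F"
  proof
    fix z assume "z \<in> O'"
    then obtain k where k: "k \<in> K" "z = k *v t" by (auto simp: O'_def)
    then have "k \<in> SO0_1n" using K(2) by blast
    then show "z \<in> ?F" using SO0_future[of k] by (simp add: k(2) SO0_isom t_def mink_axis)
  qed
  then have CF: "C \<subseteq> ?F" unfolding C_def by (rule hull_minimal) (rule convex_future_cone)
  have kC: "k *v y \<in> C" if k: "k \<in> K" and y: "y \<in> C" for k y
  proof -
    have "k *v y \<in> (*v) k ` C" using y by simp
    also have "(*v) k ` C = convex hull ((*v) k ` O')"
      unfolding C_def by (simp add: convex_hull_linear_image)
    also have "\<dots> \<subseteq> C"
      unfolding C_def
    proof (rule hull_mono)
      show "(*v) k ` O' \<subseteq> O'"
      proof
        fix z assume "z \<in> (*v) k ` O'"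
        then obtain k' where "k' \<in> K" "z = (k ** k') *v t" by (auto simp: O'_def)
        then show "z \<in> O'" using gK(2)[OF k] unfolding O'_def by blast
      qed
    qed
    finally show ?thesis .
  qed
  have uniq: "y = x" if y: "y \<in> C" and eq: "mink y y = mink x x" for y
  proof (rule ccontr)
    assume ne: "y \<noteq> x"
    define z where "z = (1/2) *\<^sub>R x + (1/2) *\<^sub>R y"
    have "z \<in> C"
      using x(1) y convexD[OF convex_convex_hull, of x O' y "1/2" "1/2"] by (simp add: z_def C_def)
    then have zz: "mink z z < 0" "mink x x \<le> mink z z" using CF x by auto
    have "mink z (x - y) = 0" using eq by (simp add: z_def mink_sym[of y x] algebra_simps)
    then have "mink (x - y) (x - y) > 0"
      by (rule mink_pos_orth_timelike[OF zz(1)]) (use ne in simp)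
    then show False using zz(2) eq by (simp add: z_def mink_sym[of y x] algebra_simps)
  qed
  have kx: "k *v x = x" if "k \<in> K" for k
    using uniq[OF kC[OF that x(1)]] isomD[OF SO0_isom, of k x x] K(2) that by auto
  have neg: "mink x x < 0" using CF x(1) by auto
  define f where "f = (1 / sqrt (- mink x x)) *\<^sub>R x"
  have "mink f f = (1 / (sqrt (- mink x x) * sqrt (- mink x x))) * mink x x" by (simp add: f_def)
  also have "\<dots> = -1" using neg by simp
  finally have "mink f f = -1" .
  moreover have "k *v f = f" if "k \<in> K" for k using kx[OF that] by (simp add: f_def)
  ultimately show thesis using that by blast
qed

section \<open>Lie algebras and bivectors\<close>

definition skew :: "('n::finite option) mat \<Rightarrow> bool" where
  "skew X \<longleftrightarrow> (\<forall>x y. mink (X *v x) y = - mink x (X *v y))"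

lemma skewD: "skew X \<Longrightarrow> mink (X *v x) y = - mink x (X *v y)"
  unfolding skew_def by blast

lemma so_of_orth_iff:
  "X \<in> so_of (mink_orth S) \<longleftrightarrow> skew X \<and> (\<forall>x\<in>S. X *v x = 0)"
proof -
  have "X *v x = 0" if "\<forall>x\<in>S. X *v x = 0" "x \<in> span S" for x
    using that(2)
    by (induction rule: span_induct_alt) (use that(1) in \<open>auto\<close>)
  then show ?thesis
    unfolding so_of_def mink_orth_mink_orth skew_def by (auto intro: span_base simp: eq_neg_iff_add_eq_0)
qed

lemma mink_orth_empty: "mink_orth {} = UNIV"
  by (simp add: mink_orth_def)

lemma so_of_UNIV_iff: "X \<in> so_of UNIV \<longleftrightarrow> skew X"
  using so_of_orth_iff[of X "{}"] by (simp add: mink_orth_empty)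

lemma subspace_so_of: "subspace (so_of U)"
  by (auto simp: so_of_def subspace_def) (simp_all add: algebra_simps flip: distrib_left)

lemma wedge_outer: "wedge x y = outer x y - outer y x"
proof -
  have "linear (\<lambda>z. mink y z *\<^sub>R x - mink x z *\<^sub>R y)"
    by (auto intro!: linearI simp: algebra_simps)
  then have "wedge x y *v z = mink y z *\<^sub>R x - mink x z *\<^sub>R y" for z
    unfolding wedge_def using fun_cong[OF matrix_vector_mul(2)] by blast
  then show ?thesis by (simp add: matrix_eq)
qed

lemma wedge_vec [simp]: "wedge x y *v z = mink y z *\<^sub>R x - mink x z *\<^sub>R y"
  by (simp add: wedge_outer)

lemma wedge_add_left: "wedge (x + x') y = wedge x y + wedge x' y"
  by (simp add: matrix_eq algebra_simps)

lemma wedge_add_right: "wedge x (y + y') = wedge x y + wedge x y'"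
  by (simp add: matrix_eq algebra_simps)

lemma wedge_scaleR_right: "wedge x (c *\<^sub>R y) = c *\<^sub>R wedge x y"
  by (simp add: matrix_eq algebra_simps)

lemma wedge_zero [simp]: "wedge 0 y = 0" "wedge x 0 = 0"
  by (simp_all add: matrix_eq)

lemma skew_wedge: "skew (wedge x y)"
  by (simp add: skew_def mink_sym)

lemma wedge_in_so_of: "x \<in> U \<Longrightarrow> y \<in> U \<Longrightarrow> wedge x y \<in> so_of U"
  using skew_wedge[of x y] by (auto simp: so_of_def skew_def mink_orth_def mink_sym)

text \<open>A self-adjoint projection onto \<open>U\<close> splits the space into \<open>U\<close> and its complement; it exists for every
  nondegenerate \<open>U\<close>.\<close>

definition mink_projection ::
    "(real ^ ('n::finite) option) set \<Rightarrow> (real ^ 'n option \<Rightarrow> real ^ 'n option) \<Rightarrow> bool" where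
  "mink_projection U P \<longleftrightarrow> subspace U \<and> linear P \<and> (\<forall>x y. mink (P x) y = mink x (P y))
     \<and> (\<forall>x. P x \<in> U) \<and> (\<forall>x\<in>U. P x = x)"

lemma mink_projection_UNIV: "mink_projection UNIV (\<lambda>z. z)"
  by (simp add: mink_projection_def linear_ident)

lemma mink_projection_timelike:
  "mink a a = -1 \<Longrightarrow> mink_projection (mink_orth {a}) (\<lambda>z. z + mink a z *\<^sub>R a)"
  by (auto simp: mink_projection_def mink_orth_insert_iff mink_sym intro!: linearI)
    (simp_all add: algebra_simps)

lemma mink_projection_pair:
  assumes "hyperbolic_pair a b" shows "mink_projection (mink_orth {a, b}) (orth_part a b)"
  using hyperbolic_pairD[OF assms] orth_part_in[OF assms]
  by (auto simp: mink_projection_def mink_orth_pair_iff orth_part_def mink_sym intro!: linearI)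
    (simp_all add: algebra_simps)

lemma so_of_vec_in:
  assumes X: "X \<in> so_of U" and U: "subspace U" shows "X *v z \<in> U"
proof -
  have "mink (X *v z) y = 0" if "y \<in> mink_orth U" for y
  proof -
    have "mink (X *v z) y + mink z (X *v y) = 0" "X *v y = 0"
      using X that unfolding so_of_def by blast+
    then show ?thesis by simp
  qed
  then have "X *v z \<in> mink_orth (mink_orth U)" by (simp add: mink_orth_def)
  then show ?thesis using U by (simp add: mink_orth_mink_orth span_eq_iff[THEN iffD2])
qed

text \<open>With the coordinate basis \<open>e i\<close> of square \<open>\<epsilon> i\<close>, a skew endomorphism \<open>X\<close> equals
  \<open>(1/2) \<Sum>i. \<epsilon> i (X (e i)) \<and> (e i)\<close>. If \<open>X\<close> vanishes on the complement of \<open>U\<close>, every \<open>e i\<close> may be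
  replaced by its projection to \<open>U\<close>.\<close>

lemma so_of_eq_bivectors:
  fixes U :: "(real ^ ('n::finite) option) set"
  assumes "mink_projection U P" shows "so_of U = bivectors U"
proof
  have U: "subspace U" and lin: "linear P" and adj: "\<And>x y. mink (P x) y = mink x (P y)"
    and PU: "\<And>x. P x \<in> U" and Pid: "\<And>x. x \<in> U \<Longrightarrow> P x = x"
    using assms by (auto simp: mink_projection_def)
  show "bivectors U \<subseteq> so_of U"
    unfolding bivectors_def by (intro span_minimal subspace_so_of) (auto intro: wedge_in_so_of)
  show "so_of U \<subseteq> bivectors U"
  proof
    fix X assume X: "X \<in> so_of U"
    have sk: "mink (X *v x) y = - mink x (X *v y)" for x y
      using X by (auto simp: so_of_def eq_neg_iff_add_eq_0)
    have XU: "X *v z \<in> U" for z by (rule so_of_vec_in[OF X U])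
    have XP: "X *v (P z) = X *v z" for z
    proof -
      have "z - P z \<in> mink_orth U" using adj Pid by (simp add: mink_orth_def)
      then have "X *v (z - P z) = 0" using X unfolding so_of_def by blast
      then show ?thesis by simp
    qed
    define e where "e i = (axis i 1 :: real ^ 'n option)" for i
    \<comment> \<open>\<open>c i\<close> is \<open>\<epsilon> i / 2\<close>\<close>
    define c where "c i = (if i = None then -1/2 else 1/2 :: real)" for i :: "'n option"
    have ce: "2 * c i * mink (e i) y = y $ i" for i y by (simp add: c_def e_def mink_axis)
    have expand: "y = (\<Sum>i\<in>UNIV. (2 * c i * mink (e i) y) *\<^sub>R e i)" for y
      unfolding ce using basis_expansion[of y] by (simp add: e_def scalar_mult_eq_scaleR)
    have "X = (\<Sum>i\<in>UNIV. c i *\<^sub>R wedge (X *v e i) (P (e i)))"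
      unfolding matrix_eq
    proof
      fix z
      have "(\<Sum>i\<in>UNIV. c i *\<^sub>R wedge (X *v e i) (P (e i))) *v z
          = (\<Sum>i\<in>UNIV. (c i * mink (e i) (P z)) *\<^sub>R (X *v e i) + (c i * mink (e i) (X *v z)) *\<^sub>R P (e i))"
        unfolding mat_vec.sum_left by (intro sum.cong) (simp_all add: adj sk scaleR_diff_right scaleR_add_right)
      also have "\<dots> = (1/2) *\<^sub>R (\<Sum>i\<in>UNIV. (2 * c i * mink (e i) (P z)) *\<^sub>R (X *v e i))
          + (1/2) *\<^sub>R (\<Sum>i\<in>UNIV. (2 * c i * mink (e i) (X *v z)) *\<^sub>R P (e i))"
        by (simp add: sum.distrib scaleR_sum_right)
      also have "(\<Sum>i\<in>UNIV. (2 * c i * mink (e i) (P z)) *\<^sub>R (X *v e i))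
          = X *v (\<Sum>i\<in>UNIV. (2 * c i * mink (e i) (P z)) *\<^sub>R e i)"
        by (simp add: mat_vec.sum_right)
      also have "\<dots> = X *v z" using expand[of "P z"] XP by simp
      also have "(\<Sum>i\<in>UNIV. (2 * c i * mink (e i) (X *v z)) *\<^sub>R P (e i))
          = P (\<Sum>i\<in>UNIV. (2 * c i * mink (e i) (X *v z)) *\<^sub>R e i)"
        using lin by (simp add: linear_sum linear_scale)
      also have "\<dots> = X *v z" using expand[of "X *v z"] Pid[OF XU] by simp
      also have "(1/2) *\<^sub>R (X *v z) + (1/2) *\<^sub>R (X *v z) = X *v z"
        by (simp flip: scaleR_left_distrib)
      finally show "X *v z = (\<Sum>i\<in>UNIV. c i *\<^sub>R wedge (X *v e i) (P (e i))) *v z" by simp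
    qed
    moreover have "(\<Sum>i\<in>UNIV. c i *\<^sub>R wedge (X *v e i) (P (e i))) \<in> bivectors U"
      unfolding bivectors_def
      by (intro span_sum span_scale span_base) (use XU PU in auto)
    ultimately show "X \<in> bivectors U" by simp
  qed
qed

lemma subspace_lie_alg:
  assumes S: "matrix_group (S :: ('m::finite) mat set)" shows "subspace (lie_alg S)"
  unfolding subspace_def
proof (intro conjI ballI allI)
  show "0 \<in> lie_alg S"
    unfolding lie_alg_def using matrix_groupD(1)[OF S]
    by (auto intro!: exI[of _ "\<lambda>_. mat 1"])
next
  fix X Y assume "X \<in> lie_alg S" "Y \<in> lie_alg S"
  then obtain f g where f: "f 0 = mat 1" "\<And>t. f t \<in> S" "(f has_vector_derivative X) (at 0)"
    and g: "g 0 = mat 1" "\<And>t. g t \<in> S" "(g has_vector_derivative Y) (at 0)"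
    by (auto simp: lie_alg_def)
  have "((\<lambda>t. f t ** g t) has_vector_derivative (f 0 ** Y + X ** g 0)) (at 0)"
    by (rule mat_mult.has_vector_derivative[OF f(3) g(3)])
  then have "((\<lambda>t. f t ** g t) has_vector_derivative (X + Y)) (at 0)"
    by (simp add: f g add.commute)
  then show "X + Y \<in> lie_alg S"
    unfolding lie_alg_def using f g matrix_groupD(2)[OF S]
    by (auto intro!: exI[of _ "\<lambda>t. f t ** g t"])
next
  fix c :: real and X assume "X \<in> lie_alg S"
  then obtain f where f: "f 0 = mat 1" "\<And>t. f t \<in> S" "(f has_vector_derivative X) (at 0)"
    by (auto simp: lie_alg_def)
  have "((f \<circ> (\<lambda>t. c * t)) has_vector_derivative (c *\<^sub>R X)) (at 0)"
    by (rule vector_diff_chain_at)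
      (auto intro!: derivative_eq_intros f(3) simp: has_real_derivative_iff_has_vector_derivative[symmetric])
  then show "c *\<^sub>R X \<in> lie_alg S"
    unfolding lie_alg_def using f
    by (auto intro!: exI[of _ "f \<circ> (\<lambda>t. c * t)"])
qed

lemma lie_alg_mono: "S \<subseteq> T \<Longrightarrow> lie_alg S \<subseteq> lie_alg T"
  unfolding lie_alg_def by blast

text \<open>Differentiate the defining equations of \<open>SO_of U\<close> along a curve through the identity.\<close>

lemma lie_alg_subset_so_of:
  assumes "S \<subseteq> SO_of U" shows "lie_alg S \<subseteq> so_of U"
proof
  fix X assume "X \<in> lie_alg S"
  then obtain f where f: "f 0 = mat 1" "\<And>t. f t \<in> S" "(f has_vector_derivative X) (at 0)"
    by (auto simp: lie_alg_def)
  have fS: "f t \<in> SO_of U" for t using f(2) assms by blast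
  have d: "((\<lambda>t. f t *v x) has_vector_derivative (X *v x)) (at 0)" for x
    using mat_vec.has_vector_derivative[OF f(3) has_vector_derivative_const[of x]] by simp
  have "mink (X *v x) y + mink x (X *v y) = 0" for x y
  proof -
    have "((\<lambda>t. mink (f t *v x) (f t *v y)) has_vector_derivative
        (mink (f 0 *v x) (X *v y) + mink (X *v x) (f 0 *v y))) (at 0)"
      by (rule mink.has_vector_derivative[OF d d])
    moreover have "(\<lambda>t. mink (f t *v x) (f t *v y)) = (\<lambda>t. mink x y)"
      using SO_ofD(1)[OF fS] by simp
    moreover have "((\<lambda>t. mink x y) has_vector_derivative 0) (at (0::real))"
      by (rule has_vector_derivative_const)
    ultimately have "mink (f 0 *v x) (X *v y) + mink (X *v x) (f 0 *v y) = 0"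
      by (metis vector_derivative_unique_at)
    then show ?thesis by (simp add: f(1) add.commute)
  qed
  moreover have "X *v x = 0" if "x \<in> mink_orth U" for x
  proof -
    have "(\<lambda>t. f t *v x) = (\<lambda>t. x)" using SO_ofD(3)[OF fS that] by simp
    then show ?thesis using d[of x] has_vector_derivative_const[of x "at (0::real)"]
      by (metis vector_derivative_unique_at)
  qed
  ultimately show "X \<in> so_of U" by (simp add: so_of_def)
qed

text \<open>Modulo \<open>x\<close> one may take \<open>y\<close> orthogonal to \<open>x\<close>. Then the curve of products of reflections in \<open>x + t y\<close> and in \<open>x\<close> passes through
  the identity with velocity \<open>- (2 / mink x x) x \<and> y\<close>.\<close>

lemma wedge_in_lie_alg:
  assumes S: "matrix_group S" and comp: "\<And>A. connected_component (SO_of U) (mat 1) A \<Longrightarrow> A \<in> S"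
    and U: "subspace U" and x: "x \<in> U" and y: "y \<in> U" and xx: "mink x x \<noteq> 0"
  shows "wedge x y \<in> lie_alg S"
proof -
  define v where "v = y - (mink x y / mink x x) *\<^sub>R x"
  have v: "v \<in> U" using U x y by (simp add: v_def subspace_diff subspace_scale)
  have xv: "mink x v = 0" "mink v x = 0" using xx by (simp_all add: v_def mink_sym[of y x])
  have wv: "wedge x v = wedge x y"
    by (simp add: v_def matrix_eq algebra_simps)
  define c where "c t = x + t *\<^sub>R v" for t :: real
  have cont: "continuous_on UNIV (\<lambda>t. mink (c t) (c t))"
    unfolding c_def by (intro mink.continuous_on continuous_intros)
  have "open {t. mink (c t) (c t) \<noteq> 0}"
    by (intro open_Collect_neq cont continuous_on_const)
  moreover have "0 \<in> {t. mink (c t) (c t) \<noteq> 0}" using xx by (simp add: c_def)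
  ultimately obtain e where e: "e > 0" "ball 0 e \<subseteq> {t. mink (c t) (c t) \<noteq> 0}"
    using open_contains_ball by blast
  define f where "f t = refl_mat (c t) ** refl_mat x" for t
  define \<gamma> where "\<gamma> t = (if \<bar>t\<bar> < e then f t else mat 1)" for t
  have "f t \<in> S" if t: "\<bar>t\<bar> < e" for t
    unfolding f_def
  proof (rule comp, rule refl_mat_segment[OF U x])
    show "c t \<in> U" using U x v by (simp add: c_def subspace_add subspace_scale)
    fix s :: real assume s: "0 \<le> s" "s \<le> 1"
    have "(1 - s) *\<^sub>R x + s *\<^sub>R c t = c (s * t)" by (simp add: c_def algebra_simps)
    moreover have "\<bar>s * t\<bar> < e"
      using s t by (simp add: abs_mult) (meson abs_ge_zero le_less_trans mult_left_le_one_le)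
    then have "s * t \<in> ball 0 e" by simp
    ultimately show "mink ((1 - s) *\<^sub>R x + s *\<^sub>R c t) ((1 - s) *\<^sub>R x + s *\<^sub>R c t) \<noteq> 0"
      using e(2) by (metis (mono_tags, lifting) mem_Collect_eq subsetD)
  qed
  then have "\<gamma> t \<in> S" for t using matrix_groupD(1)[OF S] by (simp add: \<gamma>_def)
  moreover have "\<gamma> 0 = mat 1" using e(1) by (simp add: \<gamma>_def f_def c_def refl_mat_refl_mat)
  moreover have "(\<gamma> has_vector_derivative (- (2 / mink x x) *\<^sub>R wedge x v)) (at 0)"
  proof (rule has_vector_derivative_transform_within_open)
    show "open (ball 0 e)" "0 \<in> ball 0 e" using e(1) by auto
    show "f t = \<gamma> t" if "t \<in> ball 0 e" for t using that by (simp add: \<gamma>_def)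
    have dc: "(c has_vector_derivative v) (at 0)"
      unfolding c_def by (auto intro!: derivative_eq_intros)
    have c0: "c 0 = x" by (simp add: c_def)
    have "((\<lambda>t. mink (c t) (c t)) has_vector_derivative 0) (at 0)"
      using mink.has_vector_derivative[OF dc dc] by (simp add: c0 xv)
    then have "((\<lambda>t. mink (c t) (c t)) has_field_derivative 0) (at 0)"
      by (simp add: has_real_derivative_iff_has_vector_derivative)
    then have ds: "((\<lambda>t. 2 / mink (c t) (c t)) has_field_derivative 0) (at 0)"
      by (auto intro!: derivative_eq_intros simp: c0 xx)
    have "((\<lambda>t. outer (c t) (c t)) has_vector_derivative (outer x v + outer v x)) (at 0)"
      using outer.has_vector_derivative[OF dc dc] by (simp add: c0)
    then have "((\<lambda>t. (2 / mink (c t) (c t)) *\<^sub>R outer (c t) (c t)) has_vector_derivative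
        ((2 / mink x x) *\<^sub>R (outer x v + outer v x))) (at 0)"
      using has_vector_derivative_scaleR[OF ds] by (simp add: c0)
    then have "((\<lambda>t. refl_mat (c t)) has_vector_derivative
        (- ((2 / mink x x) *\<^sub>R (outer x v + outer v x)))) (at 0)"
      unfolding refl_mat_def
      using has_vector_derivative_diff[OF has_vector_derivative_const[of "mat 1"]] by force
    then have "(f has_vector_derivative
        (- ((2 / mink x x) *\<^sub>R (outer x v + outer v x)) ** refl_mat x)) (at 0)"
      unfolding f_def
      using mat_mult.has_vector_derivative[OF _ has_vector_derivative_const[of "refl_mat x"]] by force
    moreover have "- ((2 / mink x x) *\<^sub>R (outer x v + outer v x)) ** refl_mat x
        = - (2 / mink x x) *\<^sub>R wedge x v"
    proof -
      have "mink x (refl_mat x *v z) = - mink x z" "mink v (refl_mat x *v z) = mink v z" for z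
        using xx by (simp_all add: xv)
      then show ?thesis by (simp add: matrix_eq scaleR_diff_right del: refl_mat_vec)
    qed
    ultimately show "(f has_vector_derivative (- (2 / mink x x) *\<^sub>R wedge x v)) (at 0)" by simp
  qed
  ultimately have "- (2 / mink x x) *\<^sub>R wedge x v \<in> lie_alg S"
    unfolding lie_alg_def by blast
  then have "(- (mink x x / 2)) *\<^sub>R (- (2 / mink x x) *\<^sub>R wedge x v) \<in> lie_alg S"
    using subspace_scale[OF subspace_lie_alg[OF S]] by blast
  then show ?thesis using xx by (simp add: wv)
qed

lemma lie_alg_SO_of:
  assumes P: "mink_projection U P" and pos: "pos_def_on U"
  shows "lie_alg (SO_of U) = so_of U"
proof
  have U: "subspace U" using P by (simp add: mink_projection_def)
  have grp: "matrix_group (SO_of U)" by (rule matrix_group_SO_of)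
  have "wedge x y \<in> lie_alg (SO_of U)" if "x \<in> U" "y \<in> U" for x y
  proof (cases "x = 0")
    case True
    then show ?thesis using subspace_0[OF subspace_lie_alg[OF grp]] by simp
  next
    case False
    then show ?thesis
      using wedge_in_lie_alg[OF grp _ U that] pos_def_onD[OF pos that(1)] connected_component_subset[of "SO_of U" "mat 1"]
      by force
  qed
  then show "so_of U \<subseteq> lie_alg (SO_of U)"
    unfolding so_of_eq_bivectors[OF P] bivectors_def
    by (intro span_minimal subspace_lie_alg grp) auto
qed (rule lie_alg_subset_so_of, simp)

text \<open>Bivectors with a nonisotropic factor are velocities of curves of reflections, and an isotropic
  vector is a difference of two timelike ones.\<close>

lemma lie_alg_SO0: "lie_alg (SO0_1n :: ('n::finite option) mat set) = so_of UNIV"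
proof
  let ?G = "SO0_1n :: ('n option) mat set"
  have sub: "subspace (lie_alg ?G)" by (rule subspace_lie_alg[OF matrix_group_SO0])
  have base: "wedge x y \<in> lie_alg ?G" if "mink x x \<noteq> 0" for x y
    by (rule wedge_in_lie_alg[OF matrix_group_SO0, of UNIV]) (use that in \<open>auto simp: SO0_1n_def\<close>)
  have "wedge x y \<in> lie_alg ?G" for x y
  proof (cases "mink x x = 0 \<and> x \<noteq> 0")
    case False
    then show ?thesis using base subspace_0[OF sub] by (cases "x = 0") auto
  next
    case True
    define t where "t = x $ None *\<^sub>R (axis None 1 :: real ^ 'n option)"
    have tt: "mink t t = - (x $ None)\<^sup>2" "mink t x = - (x $ None)\<^sup>2"
      by (simp_all add: t_def mink_axis power2_eq_square)
    have "x $ None \<noteq> 0"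
    proof
      assume "x $ None = 0"
      then have "space_part x = 0" using True by (simp add: mink_space_part)
      then show False using space_part_eq_0 \<open>x $ None = 0\<close> True by blast
    qed
    then have "mink (x + t) (x + t) \<noteq> 0" "mink t t \<noteq> 0"
      using True tt by (simp_all add: mink_sym[of x t])
    then have "wedge (x + t) y - wedge t y \<in> lie_alg ?G"
      by (intro subspace_diff sub base)
    then show ?thesis by (simp add: wedge_add_left)
  qed
  then show "so_of UNIV \<subseteq> lie_alg ?G"
    unfolding so_of_eq_bivectors[OF mink_projection_UNIV] bivectors_def
    by (intro span_minimal sub) auto
qed (rule lie_alg_subset_so_of, rule SO0_subset)

section \<open>An invariant Lorentz metric\<close>

text \<open>The scalar products of fundamental fields will be polynomials in the entries of the group element. They
  extend to all matrices, and their directional derivatives are polynomials again, which gives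
  smoothness of every order.\<close>

lemma real_polynomial_function_has_derivative:
  fixes p :: "'a::euclidean_space \<Rightarrow> real"
  assumes "real_polynomial_function p"
  shows "\<exists>p'. (\<forall>x. (p has_derivative p' x) (at x)) \<and> (\<forall>v. real_polynomial_function (\<lambda>x. p' x v))"
  using assms
proof induction
  case (linear f)
  then show ?case
    by (intro exI[of _ "\<lambda>x. f"]) (auto intro: bounded_linear_imp_has_derivative)
next
  case (const c)
  show ?case by (intro exI[of _ "\<lambda>x v. 0"]) auto
next
  case (add f g)
  then obtain f' g' where "\<forall>x. (f has_derivative f' x) (at x)" "\<forall>v. real_polynomial_function (\<lambda>x. f' x v)"
    "\<forall>x. (g has_derivative g' x) (at x)" "\<forall>v. real_polynomial_function (\<lambda>x. g' x v)"
    by blast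
  then show ?case
    by (intro exI[of _ "\<lambda>x v. f' x v + g' x v"]) (auto intro!: derivative_intros)
next
  case (mult f g)
  then obtain f' g' where "\<forall>x. (f has_derivative f' x) (at x)" "\<forall>v. real_polynomial_function (\<lambda>x. f' x v)"
    "\<forall>x. (g has_derivative g' x) (at x)" "\<forall>v. real_polynomial_function (\<lambda>x. g' x v)"
    by blast
  then show ?case
    using mult.hyps by (intro exI[of _ "\<lambda>x v. f x * g' x v + f' x v * g x"])
      (auto intro!: derivative_intros real_polynomial_function.intros(3,4))
qed

lemma Ck_on_real_polynomial_function:
  fixes p :: "'a::euclidean_space \<Rightarrow> real"
  shows "real_polynomial_function p \<Longrightarrow> Ck_on k UNIV p"
proof (induction k arbitrary: p)
  case 0
  then show ?case
    by (auto intro!: continuous_at_imp_continuous_on continuous_real_polymonial_function)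
next
  case (Suc k)
  obtain p' where p': "\<And>x. (p has_derivative p' x) (at x)" "\<And>v. real_polynomial_function (\<lambda>x. p' x v)"
    using real_polynomial_function_has_derivative[OF Suc.prems] by blast
  have "frechet_derivative p (at x) = p' x" for x
    using frechet_derivative_at[OF p'(1)] by simp
  moreover have "p differentiable_on UNIV"
    using p'(1) unfolding differentiable_on_def differentiable_def by blast
  ultimately show ?case using Suc.IH[OF p'(2)] by simp
qed

lemma smooth_on_real_polynomial_function:
  assumes "real_polynomial_function p" "\<And>x. x \<in> S \<Longrightarrow> f x = p x" shows "smooth_on S f"
  unfolding smooth_on_def
proof
  fix x assume "x \<in> S"
  show "\<exists>U F. open U \<and> x \<in> U \<and> (\<forall>k. Ck_on k U F) \<and> (\<forall>y\<in>S \<inter> U. F y = f y)"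
    using assms Ck_on_real_polynomial_function[OF assms(1)]
    by (intro exI[of _ UNIV] exI[of _ p]) auto
qed

lemma real_polynomial_function_mink:
  assumes f: "bounded_linear f" and g: "bounded_linear g"
  shows "real_polynomial_function (\<lambda>x. mink (f x) (g x))"
proof -
  have comp: "real_polynomial_function (\<lambda>x. h x $ i)" if "bounded_linear h" for h :: "_ \<Rightarrow> real ^ 'b option" and i
    by (intro real_polynomial_function.intros(1) bounded_linear_compose[OF bounded_linear_vec_nth that])
  show ?thesis
    unfolding mink_def
    by (intro real_polynomial_function.intros(3) real_polynomial_function_minus real_polynomial_function_sum
        real_polynomial_function.intros(4) comp f g) simp
qed

text \<open>For the base point with frame \<open>(a, b)\<close>, write \<open>X = A + s a \<and> b + a \<and> w + b \<and> w'\<close>. Then \<open>X a = s b + w\<close>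
  and \<open>X b = s a - w'\<close>, so that the form below is \<open>mink w w + mink w' w' - s\<^sup>2\<close> on the diagonal. Being
  expressed through the frame alone, it can be transported to the other points by moving the frame.\<close>

definition frame_form ::
    "real ^ ('n::finite) option \<Rightarrow> real ^ 'n option \<Rightarrow> ('n option) mat \<Rightarrow> ('n option) mat \<Rightarrow> real" where
  "frame_form a b X Y = mink (X *v a) (Y *v a) + mink (X *v b) (Y *v b) - mink (X *v a) b * mink (Y *v a) b"

lemma skew_self: "skew X \<Longrightarrow> mink x (X *v x) = 0"
  using skewD[of X x x] by (simp add: mink_sym)

lemma skew_frame:
  assumes p: "hyperbolic_pair a b" and X: "skew X"
  defines "s \<equiv> mink (X *v a) b"
  shows "X *v a = s *\<^sub>R b + orth_part a b (X *v a)" "X *v b = s *\<^sub>R a + orth_part a b (X *v b)"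
proof -
  have "mink a (X *v b) = - s" using skewD[OF X, of a b] by (simp add: s_def)
  moreover have "mink b (X *v a) = s" by (simp add: s_def mink_sym)
  ultimately show "X *v a = s *\<^sub>R b + orth_part a b (X *v a)" "X *v b = s *\<^sub>R a + orth_part a b (X *v b)"
    using orth_part_decomp[of "X *v a" a b] orth_part_decomp[of "X *v b" a b] skew_self[OF X, of a] skew_self[OF X, of b]
    by simp_all
qed

lemma frame_form_self:
  assumes p: "hyperbolic_pair a b" and X: "skew X"
  shows "frame_form a b X X = mink (orth_part a b (X *v a)) (orth_part a b (X *v a))
    + mink (orth_part a b (X *v b)) (orth_part a b (X *v b)) - (mink (X *v a) b)\<^sup>2"
proof -
  define s w w' where d: "s = mink (X *v a) b" "w = orth_part a b (X *v a)" "w' = orth_part a b (X *v b)"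
  note q = hyperbolic_pairD[OF p]
  have e: "X *v a = s *\<^sub>R b + w" "X *v b = s *\<^sub>R a + w'" using skew_frame[OF p X] by (simp_all add: d)
  have o: "mink a w = 0" "mink b w = 0" "mink a w' = 0" "mink b w' = 0"
    using orth_part_in[OF p] by (auto simp: d mink_orth_pair_iff)
  have "frame_form a b X X = mink w w + mink w' w' - s\<^sup>2"
    unfolding frame_form_def e by (simp add: q o mink_sym[of w b] mink_sym[of w' a] power2_eq_square)
  then show ?thesis by (simp add: d)
qed

text \<open>Pairing \<open>X\<close> with \<open>a \<and> w\<close>, \<open>b \<and> w'\<close> and \<open>a \<and> b\<close> isolates its three coordinates, which determines the radical.\<close>

lemma lorentzian_frame_form:
  assumes p: "hyperbolic_pair a b"
  shows "lorentzian_form (so_of UNIV) (so_of (mink_orth {a, b})) (frame_form a b)"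
  unfolding lorentzian_form_def
proof (intro conjI allI impI)
  note q = hyperbolic_pairD[OF p]
  note pos = pos_def_on_orth_pair[OF p]
  show "symmetric_form_on (so_of UNIV) (frame_form a b)"
    by (simp add: symmetric_form_on_def frame_form_def mink_sym algebra_simps)
  show "{X \<in> so_of UNIV. \<forall>Y\<in>so_of UNIV. frame_form a b X Y = 0} = so_of (mink_orth {a, b})"
  proof
    show "so_of (mink_orth {a, b}) \<subseteq> {X \<in> so_of UNIV. \<forall>Y\<in>so_of UNIV. frame_form a b X Y = 0}"
      by (auto simp: so_of_orth_iff so_of_UNIV_iff frame_form_def)
    show "{X \<in> so_of UNIV. \<forall>Y\<in>so_of UNIV. frame_form a b X Y = 0} \<subseteq> so_of (mink_orth {a, b})"
    proof
      fix X assume "X \<in> {X \<in> so_of UNIV. \<forall>Y\<in>so_of UNIV. frame_form a b X Y = 0}"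
      then have X: "skew X" and z: "frame_form a b X (wedge x y) = 0" for x y
        using wedge_in_so_of[of x UNIV y] by (auto simp: so_of_UNIV_iff)
      define s w w' where d: "s = mink (X *v a) b" "w = orth_part a b (X *v a)" "w' = orth_part a b (X *v b)"
      have e: "X *v a = s *\<^sub>R b + w" "X *v b = s *\<^sub>R a + w'" using skew_frame[OF p X] by (simp_all add: d)
      have W: "w \<in> mink_orth {a, b}" "w' \<in> mink_orth {a, b}" using orth_part_in[OF p] by (auto simp: d)
      then have o: "mink a w = 0" "mink b w = 0" "mink a w' = 0" "mink b w' = 0"
        "mink w a = 0" "mink w b = 0" "mink w' a = 0" "mink w' b = 0"
        by (auto simp: mink_orth_pair_iff mink_sym)
      have "mink w w = 0" using z[of a w] by (simp add: frame_form_def e q o)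
      then have "w = 0" using pos_def_onD[OF pos W(1)] by force
      moreover have "mink w' w' = 0" using z[of b w'] by (simp add: frame_form_def e q o)
      then have "w' = 0" using pos_def_onD[OF pos W(2)] by force
      moreover have "s = 0" using z[of a b] by (simp add: frame_form_def e q o)
      ultimately show "X \<in> so_of (mink_orth {a, b})" using X e by (simp add: so_of_orth_iff)
    qed
  qed
  show "\<exists>U. subspace U \<and> U \<subseteq> so_of UNIV \<and> negative_definite_on U (frame_form a b) \<and> dim U = 1"
  proof (intro exI[of _ "span {wedge a b}"] conjI)
    show "span {wedge a b} \<subseteq> so_of UNIV"
      by (intro span_minimal subspace_so_of) (simp add: wedge_in_so_of)
    show "negative_definite_on (span {wedge a b}) (frame_form a b)"
      by (auto simp: negative_definite_on_def span_singleton frame_form_def q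
        zero_less_mult_iff linorder_neq_iff)
    have "wedge a b *v a \<noteq> 0" using q by auto
    then have "wedge a b \<noteq> 0" by (metis matrix_vector_mult_0)
    then show "dim (span {wedge a b}) = 1" by (simp add: dim_eq_card_independent)
  qed simp
  fix U assume U: "subspace U \<and> U \<subseteq> so_of UNIV \<and> negative_definite_on U (frame_form a b)"
  \<comment> \<open>where the coefficient of \<open>a \<and> b\<close> vanishes the form is nonnegative, so this coefficient is
    injective on a negative definite subspace\<close>
  define l where "l X = mink (X *v a) b" for X
  have lin: "linear l" unfolding l_def by (auto intro!: linearI)
  have "inj_on l U"
  proof (rule linear_inj_on_iff_eq_0[OF lin, THEN iffD2])
    show "subspace U" using U by simp
    show "\<forall>X\<in>U. l X = 0 \<longrightarrow> X = 0"
    proof (intro ballI impI, rule ccontr)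
      fix X assume XU: "X \<in> U" and l0: "l X = 0" and nz: "X \<noteq> 0"
      have sk: "skew X" using XU U so_of_UNIV_iff by blast
      have nn: "mink (orth_part a b z) (orth_part a b z) \<ge> 0" for z
        using pos_def_onD[OF pos orth_part_in[OF p, of z]] by (cases "orth_part a b z = 0") auto
      have "frame_form a b X X \<ge> 0"
        unfolding frame_form_self[OF p sk] using l0 nn by (simp add: l_def)
      then show False using U XU nz by (force simp: negative_definite_on_def)
    qed
  qed
  then have "dim U = dim (l ` U)"
    using U by (intro dim_image_eq[symmetric] lin) (simp add: span_eq_iff[THEN iffD2])
  also have "\<dots> \<le> DIM(real)" by (rule dim_subset_UNIV)
  finally show "dim U \<le> 1" by simp
qed

lemma left_coset_left_coset: "left_coset g (left_coset h H) = left_coset (g ** h) H"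
  by (auto simp: left_coset_def image_image matrix_mul_assoc)

lemma left_coset_mat_1 [simp]: "left_coset (mat 1) H = H"
  by (simp add: left_coset_def)

lemma left_coset_absorb:
  assumes H: "matrix_group H" and h: "h \<in> H" shows "left_coset h H = H"
proof
  show "left_coset h H \<subseteq> H" using matrix_groupD(2)[OF H h] by (auto simp: left_coset_def)
  show "H \<subseteq> left_coset h H"
  proof
    fix k assume k: "k \<in> H"
    have "k = h ** (matrix_inv h ** k)"
      by (simp add: matrix_mul_assoc invertible_matrix_inv matrix_groupD(3)[OF H h])
    moreover have "matrix_inv h ** k \<in> H" using matrix_groupD[OF H] h k by blast
    ultimately show "k \<in> left_coset h H" unfolding left_coset_def by blast
  qed
qed

text \<open>The isotropy group of the coset of \<open>g\<close> is the conjugate by \<open>g\<close>, that is, the stabilizer of the moved frame.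
  Its Lie algebra is therefore the radical of the form attached to that frame.\<close>

lemma stabilizer_SO_of_coset:
  assumes p: "hyperbolic_pair a b" and g: "g \<in> SO0_1n"
  shows "stabilizer SO0_1n (left_coset g (SO_of (mink_orth {a, b}))) = SO_of (mink_orth {g *v a, g *v b})"
proof
  let ?H = "SO_of (mink_orth {a, b})"
  have H: "matrix_group ?H" by (rule matrix_group_SO_of)
  have iso: "isom g" by (rule SO0_isom[OF g])
  have p': "hyperbolic_pair (g *v a) (g *v b)" by (rule hyperbolic_pair_isom[OF iso p])
  show "stabilizer SO0_1n (left_coset g ?H) \<subseteq> SO_of (mink_orth {g *v a, g *v b})"
  proof
    fix A assume "A \<in> stabilizer SO0_1n (left_coset g ?H)"
    then have A: "A \<in> SO0_1n" "left_coset (A ** g) ?H = left_coset g ?H"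
      by (auto simp: stabilizer_def left_coset_left_coset)
    have "(A ** g) ** mat 1 \<in> left_coset (A ** g) ?H"
      unfolding left_coset_def using matrix_groupD(1)[OF H] by blast
    then obtain h where h: "h \<in> ?H" "A ** g = g ** h"
      unfolding A(2) by (auto simp: left_coset_def)
    have Agh: "A *v (g *v x) = g *v (h *v x)" for x using h(2) by (metis matrix_vector_mul_assoc)
    have "A *v (g *v a) = g *v a" "A *v (g *v b) = g *v b"
      using Agh h(1) by (simp_all add: SO_of_orth_iff)
    moreover have "A \<in> SO_of UNIV" using A(1) SO0_subset by blast
    ultimately show "A \<in> SO_of (mink_orth {g *v a, g *v b})"
      by (simp add: SO_of_orth_iff SO_of_UNIV_iff)
  qed
  show "SO_of (mink_orth {g *v a, g *v b}) \<subseteq> stabilizer SO0_1n (left_coset g ?H)"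
  proof
    fix A assume A: "A \<in> SO_of (mink_orth {g *v a, g *v b})"
    then have "A \<in> SO0_1n" using SO_of_subset_SO0[OF _ pos_def_on_orth_pair[OF p']] by auto
    obtain h where h: "h \<in> ?H" "A = g ** h ** matrix_inv g"
      using A SO_of_conj[OF iso, of "{a, b}"] by auto
    have "A ** g = g ** h ** (matrix_inv g ** g)" unfolding h(2) by (simp only: matrix_mul_assoc)
    then have "A ** g = g ** h" by (simp add: invertible_matrix_inv isom_invertible iso)
    then have "left_coset A (left_coset g ?H) = left_coset g (left_coset h ?H)"
      by (simp add: left_coset_left_coset)
    also have "left_coset h ?H = ?H" by (rule left_coset_absorb[OF H h(1)])
    finally show "A \<in> stabilizer SO0_1n (left_coset g ?H)"
      using \<open>A \<in> SO0_1n\<close> by (simp add: stabilizer_def)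
  qed
qed

text \<open>The metric attaches to each coset the form of its frame. It is invariant because the form depends
  on the frame only through scalar products, and smooth because it is polynomial in \<open>g\<close>.\<close>

lemma admissible_SO_of:
  fixes a b :: "real ^ ('n::finite) option"
  assumes p: "hyperbolic_pair a b"
  shows "admissible SO0_1n (SO_of (mink_orth {a, b}))"
proof -
  let ?G = "SO0_1n :: ('n option) mat set" and ?H = "SO_of (mink_orth {a, b})"
  \<comment> \<open>the frame \<open>(g a, g b)\<close> depends on the coset only, because \<open>?H\<close> fixes \<open>a\<close> and \<open>b\<close>\<close>
  define Q where "Q q = (let g = SOME g. g \<in> q in frame_form (g *v a) (g *v b))" for q :: "('n option) mat set"
  have Q: "Q (left_coset g ?H) = frame_form (g *v a) (g *v b)" for g
  proof -
    define g' where "g' = (SOME g'. g' \<in> left_coset g ?H)"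
    have "left_coset g ?H \<noteq> {}"
      using matrix_groupD(1)[OF matrix_group_SO_of] by (auto simp: left_coset_def)
    then have "g' \<in> left_coset g ?H" unfolding g'_def by (simp add: some_in_eq)
    then obtain h where h: "h \<in> ?H" "g' = g ** h" by (auto simp: left_coset_def)
    then have "g' *v a = g *v a" "g' *v b = g *v b" by (simp_all add: SO_of_orth_iff)
    then show ?thesis by (simp add: Q_def flip: g'_def)
  qed
  have "lorentzian_form (lie_alg ?G) (lie_alg (stabilizer ?G q)) (Q q)" if q: "q \<in> cosets ?G ?H" for q
  proof -
    obtain g where g: "g \<in> ?G" "q = left_coset g ?H" using q by (auto simp: cosets_def)
    have p': "hyperbolic_pair (g *v a) (g *v b)" by (rule hyperbolic_pair_isom[OF SO0_isom[OF g(1)] p])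
    show ?thesis
      using lorentzian_frame_form[OF p']
      by (simp add: g(2) Q stabilizer_SO_of_coset[OF p g(1)] lie_alg_SO0
          lie_alg_SO_of[OF mink_projection_pair[OF p'] pos_def_on_orth_pair[OF p']])
  qed
  moreover have "smooth_on ?G (\<lambda>g. Q (left_coset g ?H) X Y)" for X Y
  proof (rule smooth_on_real_polynomial_function)
    show "Q (left_coset g ?H) X Y = mink (X *v (g *v a)) (Y *v (g *v a)) + mink (X *v (g *v b)) (Y *v (g *v b))
        - mink (X *v (g *v a)) (g *v b) * mink (Y *v (g *v a)) (g *v b)" for g
      by (simp add: Q frame_form_def)
    have l: "bounded_linear (\<lambda>g :: ('n option) mat. g *v v)" "bounded_linear (\<lambda>g :: ('n option) mat. Z *v (g *v v))"
      for Z :: "('n option) mat" and v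
      by (rule mat_vec.bounded_linear_left)
        (rule bounded_linear_compose[OF mat_vec.bounded_linear_right mat_vec.bounded_linear_left])
    show "real_polynomial_function (\<lambda>g. mink (X *v (g *v a)) (Y *v (g *v a)) + mink (X *v (g *v b)) (Y *v (g *v b))
        - mink (X *v (g *v a)) (g *v b) * mink (Y *v (g *v a)) (g *v b))"
      by (intro real_polynomial_function_diff real_polynomial_function.intros(3) real_polynomial_function.intros(4)
          real_polynomial_function_mink l)
  qed
  moreover have "invariant_metric ?G ?H Q"
    unfolding invariant_metric_def
  proof (intro ballI)
    fix h q X Y assume h: "h \<in> ?G" and q: "q \<in> cosets ?G ?H"
    obtain g where g: "q = left_coset g ?H" using q by (auto simp: cosets_def)
    have "isom h" by (rule SO0_isom[OF h])
    then show "Q (left_coset h q) (Ad h X) (Ad h Y) = Q q X Y"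
      by (simp add: g left_coset_left_coset Q frame_form_def Ad_def matrix_inv_vector_cancel isom_invertible)
  qed
  moreover have "compact_connected_subgroup ?G ?H"
    by (rule compact_connected_SO_of[of a]) (use hyperbolic_pairD[OF p] in auto)
  ultimately show ?thesis
    unfolding admissible_def lorentzian_metric_def by blast
qed

section \<open>Minimality\<close>

lemma Ad_vec: "Ad g X *v z = g *v (X *v (matrix_inv g *v z))"
  by (simp add: Ad_def)

lemma Ad_wedge:
  assumes "isom g" shows "Ad g (wedge x y) = wedge (g *v x) (g *v y)"
  using isom_inv_mink[OF assms] by (simp add: matrix_eq Ad_vec mink_sym)

lemma skew_split_timelike:
  assumes a: "mink a a = -1" and X: "skew X"
  shows "X *v a \<in> mink_orth {a}" "X - wedge a (X *v a) \<in> so_of (mink_orth {a})"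
proof -
  show o: "X *v a \<in> mink_orth {a}" using skew_self[OF X] by (simp add: mink_orth_insert_iff)
  have "skew (X - wedge a (X *v a))"
    using skewD[OF X] skewD[OF skew_wedge[of a "X *v a"]] by (simp add: skew_def)
  then show "X - wedge a (X *v a) \<in> so_of (mink_orth {a})"
    using o a by (simp add: so_of_orth_iff mink_orth_insert_iff mink_sym)
qed

lemma ex_unit_orth_timelike:
  fixes f :: "real ^ ('n::finite) option"
  assumes n: "CARD('n) \<ge> 2" and f: "mink f f = -1"
  obtains b where "hyperbolic_pair f b"
proof -
  have E: "pos_def_on (mink_orth {f})" "2 \<le> dim (mink_orth {f})"
    using n f by (auto intro!: pos_def_on_orth_timelike simp: dim_orth_timelike)
  obtain z where z: "z \<in> mink_orth {f}" "z \<noteq> 0"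
    using ex_orthogonal_in[OF _ E, of 0] subspace_0[of "mink_orth {f}"] by auto
  then have zz: "mink z z > 0" using pos_def_onD[OF E(1)] by blast
  have "hyperbolic_pair f ((1 / sqrt (mink z z)) *\<^sub>R z)"
    using z zz f by (simp add: hyperbolic_pair_def mink_orth_insert_iff field_simps)
  then show thesis by (rule that)
qed

lemma symmetric_form_onD:
  assumes q: "symmetric_form_on S q"
  shows "\<And>X Y. X \<in> S \<Longrightarrow> Y \<in> S \<Longrightarrow> q X Y = q Y X"
    "\<And>X Y Z. X \<in> S \<Longrightarrow> Y \<in> S \<Longrightarrow> Z \<in> S \<Longrightarrow> q (X + Y) Z = q X Z + q Y Z"
    "\<And>c X Y. X \<in> S \<Longrightarrow> Y \<in> S \<Longrightarrow> q (c *\<^sub>R X) Y = c * q X Y"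
proof -
  have lin: "q (a *\<^sub>R X + b *\<^sub>R Y) Z = a * q X Z + b * q Y Z" if "X \<in> S" "Y \<in> S" "Z \<in> S" for X Y Z a b
    using q that unfolding symmetric_form_on_def by blast
  show "q X Y = q Y X" if "X \<in> S" "Y \<in> S" for X Y
    using q that unfolding symmetric_form_on_def by blast
  show "q (X + Y) Z = q X Z + q Y Z" if "X \<in> S" "Y \<in> S" "Z \<in> S" for X Y Z
    using lin[OF that, of 1 1] by simp
  show "q (c *\<^sub>R X) Y = c * q X Y" if "X \<in> S" "Y \<in> S" for X Y c
    using lin[OF that(1,1,2), of c 0] by simp
qed

text \<open>If the isotropy group contains the full rotation group of \<open>E = f\<^sup>\<bottom>\<close>, an invariant form lives on
  \<open>f \<and> E\<close>, where invariance under a group that is transitive on spheres makes it a multiple of the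
  form of \<open>E\<close>. Its index is then \<open>0\<close> or \<open>dim E\<close>, never one.\<close>

lemma not_admissible_full_rotations:
  fixes f :: "real ^ ('n::finite) option"
  assumes n: "CARD('n) \<ge> 2" and f: "mink f f = -1"
    and H: "matrix_group H" "SO_of (mink_orth {f}) \<subseteq> H"
  shows "\<not> admissible SO0_1n H"
proof
  let ?G = "SO0_1n :: ('n option) mat set" and ?E = "mink_orth {f}"
  assume "admissible ?G H"
  then obtain Q where HG: "H \<subseteq> ?G" and Q: "lorentzian_metric ?G H Q" "invariant_metric ?G H Q"
    by (auto simp: admissible_def compact_connected_subgroup_def)
  define q where "q = Q H"
  have E: "pos_def_on ?E" "2 \<le> dim ?E"
    using n f by (auto intro!: pos_def_on_orth_timelike simp: dim_orth_timelike)
  have "left_coset (mat 1) H \<in> cosets ?G H"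
    unfolding cosets_def by (intro imageI matrix_groupD(1)[OF matrix_group_SO0])
  then have Hc: "H \<in> cosets ?G H" by simp
  have lor: "lorentzian_form (so_of UNIV) (lie_alg (stabilizer ?G H)) q"
    using Q(1) Hc by (simp add: lorentzian_metric_def q_def lie_alg_SO0)
  then have sym: "symmetric_form_on (so_of UNIV) q"
    and rad: "{X \<in> so_of UNIV. \<forall>Y\<in>so_of UNIV. q X Y = 0} = lie_alg (stabilizer ?G H)"
    and neg: "\<exists>U. subspace U \<and> U \<subseteq> so_of UNIV \<and> negative_definite_on U q \<and> dim U = 1"
    and ind: "\<And>U. subspace U \<Longrightarrow> U \<subseteq> so_of UNIV \<Longrightarrow> negative_definite_on U q \<Longrightarrow> dim U \<le> 1"
    unfolding lorentzian_form_def by blast+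
  note form = symmetric_form_onD[OF sym]
  have wso: "wedge f x \<in> so_of UNIV" for x by (simp add: wedge_in_so_of)
  have inv: "q (Ad A X) (Ad A Y) = q X Y" if "A \<in> H" "X \<in> so_of UNIV" "Y \<in> so_of UNIV" for A X Y
  proof -
    have "Q (left_coset A H) (Ad A X) (Ad A Y) = Q H X Y"
      using Q(2) Hc that HG unfolding invariant_metric_def lie_alg_SO0 by blast
    then show ?thesis by (simp add: q_def left_coset_absorb[OF H(1) that(1)])
  qed
  have "SO_of ?E \<subseteq> stabilizer ?G H"
    using H(2) HG left_coset_absorb[OF H(1)] by (auto simp: stabilizer_def)
  then have "so_of ?E \<subseteq> lie_alg (stabilizer ?G H)"
    using lie_alg_mono lie_alg_SO_of[OF mink_projection_timelike[OF f] E(1)] by metis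
  then have radE: "q Y Z = 0" if "Y \<in> so_of ?E" "Z \<in> so_of UNIV" for Y Z
    using rad that by blast
  define \<beta> where "\<beta> x = q (wedge f x) (wedge f x)" for x
  have \<beta>_rot: "\<beta> (A *v x) = \<beta> x" if A: "A \<in> SO_of ?E" for A x
  proof -
    have "Ad A (wedge f x) = wedge f (A *v x)"
      using A by (simp add: Ad_wedge SO_of_orth_iff)
    then show ?thesis using inv[OF _ wso wso, of A x x] A H(2) by (auto simp: \<beta>_def)
  qed
  obtain b where b: "hyperbolic_pair f b" using ex_unit_orth_timelike[OF n f] .
  have bE: "b \<in> ?E" "mink b b = 1" using hyperbolic_pairD[OF b] by (simp_all add: mink_orth_insert_iff)
  have \<beta>: "\<beta> x = \<beta> b * mink x x" if x: "x \<in> ?E" for x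
  proof -
    define r where "r = sqrt (mink x x)"
    have "mink x x \<ge> 0" using mink_nonneg_orth_timelike[of f x] x f by (simp add: mink_orth_insert_iff)
    then have rr: "r * r = mink x x" by (simp add: r_def)
    have rso: "r *\<^sub>R wedge f b \<in> so_of UNIV" by (rule subspace_scale[OF subspace_so_of wso])
    have rb: "r *\<^sub>R b \<in> ?E" using bE by (simp add: subspace_scale)
    have "mink (r *\<^sub>R b) (r *\<^sub>R b) = mink x x" using rr bE by simp
    then obtain A where "A \<in> SO_of ?E" "A *v (r *\<^sub>R b) = x"
      using SO_of_transitive[OF _ E rb x] by auto
    then have "\<beta> x = \<beta> (r *\<^sub>R b)" using \<beta>_rot by metis
    also have "\<dots> = r * q (wedge f b) (r *\<^sub>R wedge f b)"
      using form(3)[OF wso rso] by (simp add: \<beta>_def wedge_scaleR_right)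
    also have "q (wedge f b) (r *\<^sub>R wedge f b) = r * \<beta> b"
      using form(1)[OF wso rso] form(3)[OF wso wso] by (simp add: \<beta>_def)
    finally show ?thesis by (simp flip: rr)
  qed
  have qX: "q X X = \<beta> (X *v f)" if X: "X \<in> so_of UNIV" for X
  proof -
    define Y where "Y = X - wedge f (X *v f)"
    have Y: "Y \<in> so_of ?E"
      unfolding Y_def by (rule skew_split_timelike[OF f]) (use X in \<open>simp add: so_of_UNIV_iff\<close>)
    have Yso: "Y \<in> so_of UNIV" unfolding Y_def by (intro subspace_diff subspace_so_of X wso)
    have XY: "X = wedge f (X *v f) + Y" by (simp add: Y_def)
    have "q X Z = q (wedge f (X *v f)) Z" if "Z \<in> so_of UNIV" for Z
      using form(2)[OF wso[of "X *v f"] Yso that] radE[OF Y that] XY by simp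
    then show ?thesis
      using form(1)[OF X wso] X wso by (metis \<beta>_def)
  qed
  obtain U where U: "subspace U" "U \<subseteq> so_of UNIV" "negative_definite_on U q" "dim U = 1"
    using neg by blast
  then obtain X where X: "X \<in> U" "X \<noteq> 0" by (metis dim_eq_0 subsetI singletonI zero_neq_one)
  have Xf: "X *v f \<in> ?E"
    using skew_split_timelike(1)[OF f] X U(2) so_of_UNIV_iff by blast
  have "\<beta> b * mink (X *v f) (X *v f) < 0"
    using U(2,3) X qX[of X] \<beta>[OF Xf] unfolding negative_definite_on_def by (metis subsetD)
  moreover have "mink (X *v f) (X *v f) \<ge> 0"
    using mink_nonneg_orth_timelike[of f "X *v f"] Xf f by (simp add: mink_orth_insert_iff)
  ultimately have c: "\<beta> b < 0" by (simp add: mult_less_0_iff)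
  have lin: "linear (wedge f)"
    by (intro linearI) (simp_all add: wedge_add_right wedge_scaleR_right)
  define U' where "U' = wedge f ` ?E"
  have wf: "wedge f x *v f = x" if "x \<in> ?E" for x
    using that f by (simp add: mink_orth_insert_iff mink_sym)
  have "dim U' \<le> 1"
  proof (rule ind)
    show "subspace U'" unfolding U'_def by (intro linear_subspace_image lin) simp
    show "U' \<subseteq> so_of UNIV" unfolding U'_def using wso by blast
    show "negative_definite_on U' q"
      unfolding negative_definite_on_def U'_def
    proof (intro ballI impI)
      fix X assume "X \<in> wedge f ` ?E" "X \<noteq> 0"
      then obtain x where x: "x \<in> ?E" "X = wedge f x" by blast
      moreover have "x \<noteq> 0" using x \<open>X \<noteq> 0\<close> by auto
      ultimately show "q X X < 0"
        using \<beta>[OF x(1)] c pos_def_onD[OF E(1) x(1)] by (simp add: \<beta>_def mult_less_0_iff)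
    qed
  qed
  moreover have "dim U' = dim ?E"
    unfolding U'_def
  proof (rule dim_image_eq[OF lin])
    have "inj_on (wedge f) ?E" by (rule inj_on_inverseI[of _ "\<lambda>X. X *v f"]) (rule wf)
    then show "inj_on (wedge f) (span ?E)" by (simp add: span_eq_iff[THEN iffD2])
  qed
  ultimately show False using E(2) by simp
qed

lemma line_same_square:
  assumes U: "subspace U" "dim U \<le> 1" "pos_def_on U" and u: "u \<in> U" "v \<in> U" "mink u u = mink v v"
  shows "v = u \<or> v = - u"
proof -
  obtain w where w: "U = span {w}" using subspace_dim_le_1_span[OF U(1,2)] .
  obtain s t where st: "u = s *\<^sub>R w" "v = t *\<^sub>R w" using u(1,2) by (auto simp: w span_singleton)
  show ?thesis
  proof (cases "w = 0")
    case False
    then have "mink w w \<noteq> 0" using pos_def_onD[OF U(3), of w] by (force simp: w span_base)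
    then have "s\<^sup>2 = t\<^sup>2" using u(3) by (simp add: st power2_eq_square)
    then have "t = s \<or> t = - s" by (metis power2_eq_iff)
    then show ?thesis by (auto simp: st)
  qed (simp add: st)
qed

text \<open>The isotropy group of \<open>b\<close> is transitive on latitudes if the complement of \<open>f\<close> and \<open>b\<close> has dimension at
  least two. Otherwise it is trivial, but then the sphere is a circle and a latitude consists of two
  points at most, which are the images of \<open>b\<close> under a rotation and its inverse.\<close>

lemma orbit_contains_latitude:
  assumes p: "hyperbolic_pair f b" and H: "matrix_group H" "H \<subseteq> SO_of (mink_orth {f})"
    and sub: "SO_of (mink_orth {f, b}) \<subseteq> H" and A: "A \<in> H"
    and y: "y \<in> mink_orth {f}" "mink y y = 1" "mink y b = mink (A *v b) b"
  obtains B where "B \<in> H" "B *v b = y"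
proof -
  note q = hyperbolic_pairD[OF p]
  let ?U = "mink_orth {f, b}" and ?E = "mink_orth {f}"
  have pos: "pos_def_on ?U" by (rule pos_def_on_orth_pair[OF p])
  have posE: "pos_def_on ?E" by (rule pos_def_on_orth_timelike[of f]) (use q in auto)
  have AE: "A \<in> SO_of ?E" using A H(2) by blast
  note Ai = SO_ofD(1)[OF AE]
  have bE: "b \<in> ?E" using q by (simp add: mink_orth_insert_iff)
  define c where "c = mink y b"
  define u where "u = A *v b - c *\<^sub>R b"
  define v where "v = y - c *\<^sub>R b"
  have AbE: "A *v b \<in> ?E" by (rule SO_of_preserves[OF AE _ bE]) simp
  have c: "mink (A *v b) b = c" "mink b (A *v b) = c" "mink y b = c" "mink b y = c"
    using y(3) by (simp_all add: c_def mink_sym)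
  have u: "u \<in> ?U" using AbE bE c q by (simp add: u_def mink_orth_pair_iff mink_orth_insert_iff)
  have v: "v \<in> ?U" using y(1) bE c q by (simp add: v_def mink_orth_pair_iff mink_orth_insert_iff)
  have uv: "mink u u = mink v v" using c q Ai y(2) by (simp add: u_def v_def)
  show thesis
  proof (cases "v = u")
    case True
    then have "A *v b = y" by (simp add: u_def v_def)
    then show thesis using that A by blast
  next
    case ne: False
    show thesis
    proof (cases "2 \<le> dim ?U")
      case True
      obtain B where B: "B \<in> SO_of ?U" "B *v u = v"
        using SO_of_transitive[OF _ pos True u v uv] by auto
      have "B *v b = b" using B(1) by (simp add: SO_of_orth_iff)
      then have "(B ** A) *v b = y"
        using B(2) by (simp add: u_def v_def)
      moreover have "B ** A \<in> H" using B(1) sub A matrix_groupD(2)[OF H(1)] by blast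
      ultimately show thesis by (rule that[rotated])
    next
      case False
      then have d: "dim ?U \<le> 1" by simp
      have vu: "v = - u" using line_same_square[OF _ d pos u v uv] ne by simp
      define x where "x = A *v b"
      have xb: "x \<noteq> - b"
      proof
        assume "x = - b"
        then have "c = -1" using c(1) q by (simp add: x_def)
        then have "u = 0" using \<open>x = - b\<close> by (simp add: u_def x_def)
        then show False using vu ne by simp
      qed
      have xx: "mink b b = mink x x" using Ai by (simp add: x_def)
      define R where "R = refl_mat (b + x) ** refl_mat b"
      have rot: "connected_component (SO_of ?E) (mat 1) R" "R *v b = x"
        using rotation_not_antipodal[OF _ posE bE _ xx xb] AbE
        by (simp_all add: x_def R_def del: refl_mat_vec)
      have RE: "R \<in> SO_of ?E" using rot(1) connected_component_in by blast
      have Rinv: "matrix_inv R = refl_mat b ** refl_mat (b + x)"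
      proof (rule matrix_inv_unique(1))
        have "R ** (refl_mat b ** refl_mat (b + x))
            = refl_mat (b + x) ** (refl_mat b ** refl_mat b) ** refl_mat (b + x)"
          by (simp only: R_def matrix_mul_assoc)
        then show "R ** (refl_mat b ** refl_mat (b + x)) = mat 1" by (simp add: refl_mat_refl_mat)
      qed
      note Rv = invertible_matrix_inv[OF isom_invertible[OF SO_ofD(1)[OF RE]]]
      have "matrix_inv R ** A \<in> SO_of ?E"
        using matrix_groupD[OF matrix_group_SO_of] RE AE by blast
      moreover have "(matrix_inv R ** A) *v b = b"
        using rot(2) Rv(2) by (metis matrix_vector_mul_assoc matrix_vector_mul_lid x_def)
      ultimately have "matrix_inv R ** A \<in> SO_of ?U" by (simp add: SO_of_orth_iff)
      then have "matrix_inv R ** A = mat 1" using SO_of_dim_le_1[OF _ pos d] by simp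
      \<comment> \<open>\<open>A\<close> is the product \<open>R\<close> of two reflections, whose inverse is computed by reversing the factors\<close>
      then have "A = R" using Rv(1) by (metis matrix_mul_assoc matrix_mul_lid matrix_mul_rid)
      have bx: "mink b x = c" using c by (simp add: x_def)
      have "mink (b + x) (b + x) > 0"
        using pos_def_onD[OF posE, of "b + x"] bE AbE xb
        by (simp add: x_def subspace_add add_eq_0_iff del: mink_simps)
      then have "refl_mat (b + x) *v b = - x" by (intro refl_mat_sum_swap xx) simp
      then have "matrix_inv R *v b = refl_mat b *v (- x)"
        by (simp add: Rinv del: refl_mat_vec)
      also have "\<dots> = c *\<^sub>R b - u"
        using q bx by (simp add: u_def x_def scaleR_2 flip: scaleR_scaleR)
      also have "\<dots> = y" using vu by (simp add: v_def algebra_simps)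
      finally show thesis using that matrix_groupD(4)[OF H(1) A] \<open>A = R\<close> by blast
    qed
  qed
qed

text \<open>A connected group strictly larger than the isotropy group of \<open>b\<close> moves \<open>b\<close>. The heights
  \<open>mink x b\<close> over the orbit form an interval ending at \<open>1\<close>, so the orbit contains a cap around \<open>b\<close>.
  Moving the cap about shows that the orbit is open in the unit sphere; being compact, it is the sphere.\<close>

lemma connected_group_contains_rotations:
  fixes f b :: "real ^ ('n::finite) option"
  assumes n: "CARD('n) \<ge> 2" and p: "hyperbolic_pair f b"
    and H: "matrix_group H" "H \<subseteq> SO_of (mink_orth {f})" "compact H" "connected H"
    and sub: "SO_of (mink_orth {f, b}) \<subset> H"
  shows "SO_of (mink_orth {f}) \<subseteq> H"
proof -
  note q = hyperbolic_pairD[OF p]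
  let ?E = "mink_orth {f}"
  have E: "pos_def_on ?E" "2 \<le> dim ?E"
    using n q by (auto intro!: pos_def_on_orth_timelike simp: dim_orth_timelike)
  have bE: "b \<in> ?E" using q by (simp add: mink_orth_insert_iff)
  have nn: "mink z z \<ge> 0" if "z \<in> ?E" for z
    using mink_nonneg_orth_timelike[of f z] that q by (simp add: mink_orth_insert_iff)
  have HE: "A *v x \<in> ?E" "mink (A *v x) (A *v y) = mink x y" if "A \<in> H" "x \<in> ?E" for A x y
    using that H(2) SO_of_preserves[of A ?E x] SO_ofD(1)[of A ?E] by auto
  have cont: "continuous_on S (\<lambda>A. A *v b)" for S :: "('n option) mat set"
    by (intro mat_vec.continuous_on continuous_on_id continuous_on_const)
  define O' where "O' = (\<lambda>A. A *v b) ` H"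
  define Sph where "Sph = {x \<in> ?E. mink x x = 1}"
  have OS: "O' \<subseteq> Sph" using HE bE q by (auto simp: O'_def Sph_def)
  have "Sph = (\<lambda>A. A *v b) ` SO_of ?E"
  proof
    show "Sph \<subseteq> (\<lambda>A. A *v b) ` SO_of ?E"
    proof
      fix x assume "x \<in> Sph"
      then obtain A where "A \<in> SO_of ?E" "A *v b = x"
        using SO_of_transitive[OF _ E bE, of x] q by (auto simp: Sph_def)
      then show "x \<in> (\<lambda>A. A *v b) ` SO_of ?E" by blast
    qed
    show "(\<lambda>A. A *v b) ` SO_of ?E \<subseteq> Sph"
      using SO_of_preserves[OF _ _ bE] q by (auto simp: Sph_def SO_ofD(1))
  qed
  then have "connected Sph"
    using connected_continuous_image[OF cont connected_SO_of[OF _ E(1)]] by simp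
  obtain A0 where A0: "A0 \<in> H" "A0 \<notin> SO_of (mink_orth {f, b})" using sub by blast
  have "A0 *v b \<noteq> b"
    using A0 H(2) by (auto simp: SO_of_orth_iff)
  define c0 where "c0 = mink (A0 *v b) b"
  have "mink (A0 *v b - b) (A0 *v b - b) > 0"
    using \<open>A0 *v b \<noteq> b\<close> HE(1)[OF A0(1) bE] bE
    by (intro pos_def_onD[OF E(1)]) (simp_all add: subspace_diff)
  then have c0: "c0 < 1" using HE(2)[OF A0(1) bE] q by (simp add: c0_def mink_sym[of b "A0 *v b"])
  have "mat 1 \<in> H" by (rule matrix_groupD(1)[OF H(1)])
  have "connected O'" unfolding O'_def by (rule connected_continuous_image[OF cont H(4)])
  then have "connected ((\<lambda>x. mink x b) ` O')"
    by (rule connected_continuous_image[rotated])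
      (intro mink.continuous_on continuous_on_id continuous_on_const)
  then have int: "is_interval ((\<lambda>x. mink x b) ` O')" by (simp add: is_interval_connected_1)
  have h: "c0 \<in> (\<lambda>x. mink x b) ` O'" "1 \<in> (\<lambda>x. mink x b) ` O'"
  proof -
    show "c0 \<in> (\<lambda>x. mink x b) ` O'" using A0(1) by (auto simp: c0_def O'_def)
    have "mat 1 *v b \<in> O'" unfolding O'_def using \<open>mat 1 \<in> H\<close> by blast
    then show "1 \<in> (\<lambda>x. mink x b) ` O'" using q by force
  qed
  have cap: "y \<in> O'" if y: "y \<in> Sph" "c0 \<le> mink y b" for y
  proof -
    have "mink (y - b) (y - b) \<ge> 0" using y(1) bE by (intro nn) (simp add: Sph_def subspace_diff)
    then have "mink y b \<le> 1" using y(1) q by (simp add: Sph_def mink_sym[of b y])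
    then have "mink y b \<in> (\<lambda>x. mink x b) ` O'"
      using mem_is_interval_1_I[OF int h] y(2) by blast
    then obtain A where A: "A \<in> H" "mink y b = mink (A *v b) b" by (auto simp: O'_def)
    have "y \<in> ?E" "mink y y = 1" using y(1) by (auto simp: Sph_def)
    then obtain B where "B \<in> H" "B *v b = y"
      using orbit_contains_latitude[OF p H(1,2) _ A(1) _ _ A(2)] sub by blast
    then show ?thesis by (auto simp: O'_def)
  qed
  have "O' = Sph \<inter> (\<Union>A\<in>H. {y. c0 < mink y (A *v b)})"
  proof
    show "O' \<subseteq> Sph \<inter> (\<Union>A\<in>H. {y. c0 < mink y (A *v b)})"
    proof
      fix x assume x: "x \<in> O'"
      then obtain A where "A \<in> H" "x = A *v b" by (auto simp: O'_def)
      moreover have "x \<in> Sph" using x OS by blast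
      ultimately have "c0 < mink x (A *v b)" using c0 by (simp add: Sph_def)
      then show "x \<in> Sph \<inter> (\<Union>A\<in>H. {y. c0 < mink y (A *v b)})"
        using \<open>x \<in> Sph\<close> \<open>A \<in> H\<close> by blast
    qed
    show "Sph \<inter> (\<Union>A\<in>H. {y. c0 < mink y (A *v b)}) \<subseteq> O'"
    proof
      fix y assume "y \<in> Sph \<inter> (\<Union>A\<in>H. {y. c0 < mink y (A *v b)})"
      then obtain A where A: "A \<in> H" and y: "y \<in> Sph" "c0 < mink y (A *v b)" by blast
      have Ai: "isom A" using A H(2) SO_ofD(1) by blast
      have iA: "matrix_inv A \<in> H" by (rule matrix_groupD(4)[OF H(1) A])
      have "matrix_inv A *v y \<in> Sph" using y(1) HE[OF iA] by (auto simp: Sph_def)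
      moreover have "mink (matrix_inv A *v y) b = mink y (A *v b)" by (rule isom_inv_mink[OF Ai])
      ultimately have "matrix_inv A *v y \<in> O'" using y(2) by (intro cap) auto
      then obtain B where B: "B \<in> H" "matrix_inv A *v y = B *v b" by (auto simp: O'_def)
      have "y = (A ** B) *v b"
        using B(2) matrix_inv_vector_cancel(1)[OF isom_invertible[OF Ai], of y] by simp
      moreover have "A ** B \<in> H" using matrix_groupD(2)[OF H(1) A B(1)] .
      ultimately show "y \<in> O'" unfolding O'_def by blast
    qed
  qed
  moreover have "open (\<Union>A\<in>H. {y. c0 < mink y (A *v b)})"
    by (intro open_UN ballI open_Collect_less mink.continuous_on continuous_on_id continuous_on_const)
  ultimately have "openin (top_of_set Sph) O'" by (metis openin_open_Int)
  moreover have "compact O'" unfolding O'_def by (rule compact_continuous_image[OF cont H(3)])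
  then have "closedin (top_of_set Sph) O'"
    using OS by (simp add: closed_subset compact_imp_closed)
  ultimately have "O' = {} \<or> O' = Sph"
    using \<open>connected Sph\<close> unfolding connected_clopen by blast
  then have full: "O' = Sph" using \<open>mat 1 \<in> H\<close> by (auto simp: O'_def)
  show ?thesis
  proof
    fix B assume B: "B \<in> SO_of ?E"
    then have "B *v b \<in> Sph"
      using SO_of_preserves[OF B _ bE] q by (simp add: Sph_def SO_ofD(1))
    then obtain A where A: "A \<in> H" "A *v b = B *v b" using full by (auto simp: O'_def)
    have AE: "A \<in> SO_of ?E" using A H(2) by blast
    have inv: "invertible A" using isom_invertible SO_ofD(1)[OF AE] by blast
    have "matrix_inv A ** B \<in> SO_of ?E" using matrix_groupD[OF matrix_group_SO_of] AE B by blast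
    moreover have "(matrix_inv A ** B) *v b = b"
      using A(2) matrix_inv_vector_cancel(2)[OF inv, of b] by simp
    ultimately have "matrix_inv A ** B \<in> SO_of (mink_orth {f, b})" by (simp add: SO_of_orth_iff)
    then have "matrix_inv A ** B \<in> H" using sub by blast
    then have "A ** (matrix_inv A ** B) \<in> H" using matrix_groupD(2)[OF H(1) A(1)] by blast
    then show "B \<in> H" by (simp add: matrix_mul_assoc invertible_matrix_inv[OF inv])
  qed
qed

text \<open>Some rotation maps \<open>w\<close> to \<open>- w\<close>.\<close>

lemma fixed_vector_eq_0:
  assumes U: "subspace U" "pos_def_on U" "2 \<le> dim U" and w: "w \<in> U"
    and inv: "\<And>A. A \<in> SO_of U \<Longrightarrow> A *v w = w"
  shows "w = 0"
proof -
  obtain A where "A \<in> SO_of U" "A *v w = - w" using SO_of_neg[OF U w] .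
  then have "w = - w" using inv by metis
  then have "2 *\<^sub>R w = 0" by (simp add: scaleR_2)
  then show ?thesis by simp
qed

text \<open>A larger compact group fixes a unit timelike vector \<open>f\<close>, and the given group is the isotropy group of a
  hyperbolic pair containing \<open>f\<close>. When \<open>W = {a, b}\<^sup>\<bottom>\<close> has dimension at least two, \<open>f\<close> lies in the
  plane of \<open>a\<close> and \<open>b\<close>; when \<open>W\<close> is a line the group is trivial, and any pair will do.\<close>

lemma minimal_admissible_SO_of:
  fixes a b :: "real ^ ('n::finite) option"
  assumes n: "CARD('n) \<ge> 2" and p: "hyperbolic_pair a b"
  shows "minimal_admissible SO0_1n (SO_of (mink_orth {a, b}))"
  unfolding minimal_admissible_def
proof (intro conjI notI admissible_SO_of[OF p])
  let ?G = "SO0_1n :: ('n option) mat set" and ?W = "mink_orth {a, b}"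
  note q = hyperbolic_pairD[OF p]
  note pos = pos_def_on_orth_pair[OF p]
  assume "\<exists>H'. compact_connected_subgroup ?G H' \<and> SO_of ?W \<subset> H' \<and> admissible ?G H'"
  then obtain H where H: "matrix_group H" "H \<subseteq> ?G" "compact H" "connected H"
    and sub: "SO_of ?W \<subset> H" and adm: "admissible ?G H"
    by (auto simp: compact_connected_subgroup_def)
  obtain f where f: "mink f f = -1" "\<And>h. h \<in> H \<Longrightarrow> h *v f = f"
    using compact_subgroup_fixes_timelike[OF H(1-3)] by blast
  obtain b' where b': "hyperbolic_pair f b'" "SO_of (mink_orth {f, b'}) = SO_of ?W"
  proof (cases "2 \<le> dim ?W")
    case True
    have "orth_part a b f = 0"
    proof (rule fixed_vector_eq_0[OF _ pos True orth_part_in[OF p]])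
      fix A assume A: "A \<in> SO_of ?W"
      then have "A *v f = f" "A *v a = a" "A *v b = b" using f(2) sub by (auto simp: SO_of_orth_iff)
      then show "A *v orth_part a b f = orth_part a b f" by (simp add: orth_part_def)
    qed simp
    then obtain \<alpha> \<beta> where fab: "f = \<alpha> *\<^sub>R a + \<beta> *\<^sub>R b"
      using orth_part_decomp[of f a b] by (metis add.right_neutral)
    have ab: "\<alpha> * \<alpha> = \<beta> * \<beta> + 1" using f(1) q by (simp add: fab)
    \<comment> \<open>\<open>f\<close> and \<open>b'\<close> arise from \<open>a\<close> and \<open>b\<close> by a boost in their plane, up to a sign\<close>
    define b' where "b' = \<beta> *\<^sub>R a + \<alpha> *\<^sub>R b"
    have "hyperbolic_pair f b'" using q ab by (simp add: hyperbolic_pair_def fab b'_def)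
    moreover have "a = \<alpha> *\<^sub>R f - \<beta> *\<^sub>R b'" "b = \<alpha> *\<^sub>R b' - \<beta> *\<^sub>R f"
      by (simp_all add: fab b'_def algebra_simps ab)
    then have "A *v a = a \<and> A *v b = b \<longleftrightarrow> A *v f = f \<and> A *v b' = b'" for A
      using fab b'_def by (metis matrix_vector_right_distrib matrix_vector_mult_scaleR matrix_vector_mult_diff_distrib)
    then have "SO_of (mink_orth {f, b'}) = SO_of ?W" by (auto simp: SO_of_orth_iff)
    ultimately show thesis by (rule that)
  next
    case False
    then have W1: "SO_of ?W = {mat 1}" by (intro SO_of_dim_le_1 pos) auto
    obtain b' where b': "hyperbolic_pair f b'" using ex_unit_orth_timelike[OF n f(1)] .
    have "dim (mink_orth {f, b'}) \<le> 1" using False dim_orth_pair[OF p] dim_orth_pair[OF b'] by simp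
    then have "SO_of (mink_orth {f, b'}) = {mat 1}"
      by (intro SO_of_dim_le_1 pos_def_on_orth_pair[OF b']) auto
    then show thesis using that b' W1 by simp
  qed
  have "H \<subseteq> SO_of (mink_orth {f})"
    using f(2) H(2) SO0_subset by (force simp: SO_of_orth_iff SO_of_UNIV_iff)
  then have "SO_of (mink_orth {f}) \<subseteq> H"
    using connected_group_contains_rotations[OF n b'(1) H(1) _ H(3,4)] sub b'(2) by simp
  then show False using not_admissible_full_rotations[OF n f(1) H(1)] adm by blast
qed

section \<open>Maximal compact subgroups and class II\<close>

lemma compact_subgroup_subset_stabilizer:
  assumes K: "matrix_group K" "K \<subseteq> SO0_1n" "compact K"
  obtains f where "mink f f = -1" "K \<subseteq> SO_of (mink_orth {f})"
proof -
  obtain f where f: "mink f f = -1" "\<And>k. k \<in> K \<Longrightarrow> k *v f = f"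
    using compact_subgroup_fixes_timelike[OF K] by blast
  have "K \<subseteq> SO_of (mink_orth {f})"
    using f(2) K(2) SO0_subset by (force simp: SO_of_orth_iff SO_of_UNIV_iff)
  then show thesis using that f(1) by blast
qed

text \<open>A compact subgroup lies in the stabilizer of a timelike vector, which is itself compact.\<close>

lemma maximal_compact_subgroupE:
  assumes "maximal_compact_subgroup SO0_1n K"
  obtains f where "mink f f = -1" "K = SO_of (mink_orth {f})"
proof -
  have K: "matrix_group K" "K \<subseteq> SO0_1n" "compact K"
    and max: "\<And>K'. matrix_group K' \<Longrightarrow> K' \<subseteq> SO0_1n \<Longrightarrow> compact K' \<Longrightarrow> \<not> K \<subset> K'"
    using assms by (auto simp: maximal_compact_subgroup_def)
  obtain f where f: "mink f f = -1" "K \<subseteq> SO_of (mink_orth {f})"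
    using compact_subgroup_subset_stabilizer[OF K] .
  have "compact_connected_subgroup SO0_1n (SO_of (mink_orth {f}))"
    by (rule compact_connected_SO_of[of f]) (use f in auto)
  then have "\<not> K \<subset> SO_of (mink_orth {f})"
    by (intro max) (auto simp: compact_connected_subgroup_def)
  then show thesis using that f by blast
qed

text \<open>A compact group containing \<open>SO_of (mink_orth {a})\<close> fixes a timelike vector, and the rotations of the complement
  of \<open>a\<close> leave no choice for it but a multiple of \<open>a\<close>.\<close>

lemma maximal_compact_subgroup_SO_of:
  fixes a :: "real ^ ('n::finite) option"
  assumes n: "CARD('n) \<ge> 2" and a: "mink a a = -1"
  shows "maximal_compact_subgroup SO0_1n (SO_of (mink_orth {a}))"
proof -
  let ?E = "mink_orth {a}"
  have cc: "compact_connected_subgroup SO0_1n (SO_of ?E)"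
    by (rule compact_connected_SO_of[of a]) (use a in auto)
  have E: "pos_def_on ?E" "2 \<le> dim ?E"
    using n a by (auto intro!: pos_def_on_orth_timelike simp: dim_orth_timelike)
  have "\<not> SO_of ?E \<subset> K" if K: "matrix_group K" "K \<subseteq> SO0_1n" "compact K" for K
  proof
    assume sub: "SO_of ?E \<subset> K"
    obtain f where f: "mink f f = -1" "K \<subseteq> SO_of (mink_orth {f})"
      using compact_subgroup_subset_stabilizer[OF K] .
    define y where "y = f + mink a f *\<^sub>R a"
    have "y = 0"
    proof (rule fixed_vector_eq_0[OF _ E])
      show "y \<in> ?E" using a by (simp add: y_def mink_orth_insert_iff)
      fix A assume A: "A \<in> SO_of ?E"
      then have "A *v a = a" by (simp add: SO_of_orth_iff)
      moreover have "A *v f = f" using A sub f(2) by (force simp: SO_of_orth_iff)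
      ultimately show "A *v y = y" by (simp add: y_def)
    qed simp
    then have fa: "f = - mink a f *\<^sub>R a" unfolding y_def by (metis add_eq_0_iff2 scaleR_minus_left)
    have "mink a f \<noteq> 0"
    proof
      assume "mink a f = 0"
      then have "f = 0" using fa by simp
      then show False using f(1) by simp
    qed
    have "K \<subseteq> SO_of ?E"
    proof
      fix k assume "k \<in> K"
      then have k: "isom k" "det k = 1" "k *v f = f" using f(2) by (auto simp: SO_of_orth_iff)
      have "(- mink a f) *\<^sub>R (k *v a) = (- mink a f) *\<^sub>R a"
        using k(3) fa by (metis matrix_vector_mult_scaleR)
      then have "k *v a = a" using \<open>mink a f \<noteq> 0\<close> by simp
      then show "k \<in> SO_of ?E" using k by (simp add: SO_of_orth_iff)
    qed
    then show False using sub by blast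
  qed
  then show ?thesis
    using cc unfolding maximal_compact_subgroup_def compact_connected_subgroup_def by blast
qed

lemma subspace_wedge_image: "subspace U \<Longrightarrow> subspace (wedge a ` U)"
  by (intro linear_subspace_image linearI) (simp_all add: wedge_add_right wedge_scaleR_right)

lemma wedge_timelike_vec: "mink a a = -1 \<Longrightarrow> x \<in> mink_orth {a} \<Longrightarrow> wedge a x *v a = x"
  by (simp add: mink_orth_insert_iff mink_sym)

lemma symmetric_decomposition_SO_of:
  assumes a: "mink a a = -1"
  shows "symmetric_decomposition SO0_1n (SO_of (mink_orth {a})) (wedge a ` mink_orth {a})"
proof -
  let ?E = "mink_orth {a}"
  have pos: "pos_def_on ?E" by (rule pos_def_on_orth_timelike[of a]) (use a in auto)
  have lk: "lie_alg (SO_of ?E) = so_of ?E"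
    by (rule lie_alg_SO_of[OF mink_projection_timelike[OF a] pos])
  have Ya: "Y *v a = 0" "skew Y" if "Y \<in> so_of ?E" for Y using that by (auto simp: so_of_orth_iff)
  have "direct_sum (so_of UNIV) (so_of ?E) (wedge a ` ?E)"
    unfolding direct_sum_def
  proof (intro conjI subspace_so_of subspace_wedge_image subspace_mink_orth)
    show "so_of ?E \<inter> wedge a ` ?E = {0}"
    proof
      show "so_of ?E \<inter> wedge a ` ?E \<subseteq> {0}"
      proof
        fix X assume X: "X \<in> so_of ?E \<inter> wedge a ` ?E"
        then obtain x where x: "x \<in> ?E" "X = wedge a x" by blast
        then have "x = 0" using wedge_timelike_vec[OF a] Ya(1) X by (metis IntD1)
        then show "X \<in> {0}" by (simp add: x)
      qed
      show "{0} \<subseteq> so_of ?E \<inter> wedge a ` ?E"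
        using subspace_0[OF subspace_so_of] subspace_0[OF subspace_wedge_image[OF subspace_mink_orth]]
        by blast
    qed
    show "so_of UNIV = {X + Y |X Y. X \<in> so_of ?E \<and> Y \<in> wedge a ` ?E}"
    proof
      show "so_of UNIV \<subseteq> {X + Y |X Y. X \<in> so_of ?E \<and> Y \<in> wedge a ` ?E}"
      proof
        fix X :: "('a option) mat" assume "X \<in> so_of UNIV"
        then have sk: "skew X" by (simp add: so_of_UNIV_iff)
        have "X = (X - wedge a (X *v a)) + wedge a (X *v a)" by simp
        then show "X \<in> {X + Y |X Y. X \<in> so_of ?E \<and> Y \<in> wedge a ` ?E}"
          using skew_split_timelike[OF a sk] by blast
      qed
      show "{X + Y |X Y. X \<in> so_of ?E \<and> Y \<in> wedge a ` ?E} \<subseteq> so_of UNIV"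
        using wedge_in_so_of[of _ UNIV]
        by (auto intro!: subspace_add[OF subspace_so_of] simp: so_of_orth_iff so_of_UNIV_iff skew_wedge)
    qed
  qed
  moreover have "lie_bracket Y (wedge a x) \<in> wedge a ` ?E" if Y: "Y \<in> so_of ?E" and x: "x \<in> ?E" for Y x
  proof
    have Y2: "mink a (Y *v z) = 0" "mink (Y *v z) w = - mink z (Y *v w)" for z w
      using skewD[OF Ya(2)[OF Y]] skewD[OF Ya(2)[OF Y], of a z] by (simp_all add: Ya(1)[OF Y])
    show "lie_bracket Y (wedge a x) = wedge a (Y *v x)"
      by (simp add: matrix_eq lie_bracket_def Ya(1)[OF Y] Y2)
    show "Y *v x \<in> ?E" by (simp add: mink_orth_insert_iff Y2)
  qed
  moreover have "lie_bracket (wedge a x) (wedge a y) \<in> so_of ?E" if x: "x \<in> ?E" and y: "y \<in> ?E" for x y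
    using x y a
    by (simp add: so_of_orth_iff skew_def lie_bracket_def mink_orth_insert_iff mink_sym algebra_simps)
  ultimately show ?thesis
    unfolding symmetric_decomposition_def lie_alg_SO0 lk by blast
qed

lemma wedge_pair_nonzero: "hyperbolic_pair a b \<Longrightarrow> wedge a b \<noteq> 0"
proof
  assume p: "hyperbolic_pair a b" and "wedge a b = 0"
  then have "mink (wedge a b *v a) b = 0" by simp
  then show False using hyperbolic_pairD[OF p] by simp
qed

lemma class_II_SO_of:
  fixes a b :: "real ^ ('n::finite) option"
  assumes n: "CARD('n) \<ge> 2" and p: "hyperbolic_pair a b"
  shows "class_II SO0_1n (SO_of (mink_orth {a, b}))"
  unfolding class_II_def
proof (intro conjI exI admissible_SO_of[OF p])
  note q = hyperbolic_pairD[OF p]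
  show "maximal_compact_subgroup SO0_1n (SO_of (mink_orth {a}))"
    by (rule maximal_compact_subgroup_SO_of[OF n q(1)])
  show "SO_of (mink_orth {a, b}) \<subseteq> SO_of (mink_orth {a})"
    by (auto simp: SO_of_orth_iff)
  show "symmetric_decomposition SO0_1n (SO_of (mink_orth {a})) (wedge a ` mink_orth {a})"
    by (rule symmetric_decomposition_SO_of[OF q(1)])
  have "Ad h (wedge a b) = wedge a b" if "h \<in> SO_of (mink_orth {a, b})" for h
    using that by (simp add: Ad_wedge SO_of_orth_iff)
  then have "wedge a b \<in> Ad_fixed (SO_of (mink_orth {a, b})) (wedge a ` mink_orth {a})"
    using q by (simp add: Ad_fixed_def mink_orth_insert_iff)
  then show "Ad_fixed (SO_of (mink_orth {a, b})) (wedge a ` mink_orth {a}) \<noteq> {0}"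
    using wedge_pair_nonzero[OF p] by blast
qed

text \<open>Let \<open>K\<close> be the stabilizer of the timelike vector \<open>f\<close>. A nonzero \<open>X\<close> fixed by \<open>H\<close> in a complement of
  the Lie algebra of \<open>K\<close> does not annihilate \<open>f\<close>, and \<open>H\<close> fixes both \<open>f\<close> and \<open>X f\<close>. So \<open>H\<close> is contained in the
  isotropy group of the hyperbolic pair that they span, and equals it by minimality.\<close>

lemma minimal_class_II_imp_SO_of:
  fixes H :: "(('n::finite) option) mat set"
  assumes min: "minimal_admissible SO0_1n H" and cl: "class_II SO0_1n H"
  obtains a b where "hyperbolic_pair a b" "H = SO_of (mink_orth {a, b})"
proof -
  obtain K P where K: "maximal_compact_subgroup SO0_1n K" "H \<subseteq> K"
    and sd: "symmetric_decomposition SO0_1n K P" and fx: "Ad_fixed H P \<noteq> {0}"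
    using cl unfolding class_II_def by blast
  obtain f where f: "mink f f = -1" "K = SO_of (mink_orth {f})"
    using maximal_compact_subgroupE[OF K(1)] .
  let ?E = "mink_orth {f}"
  have pos: "pos_def_on ?E" by (rule pos_def_on_orth_timelike[of f]) (use f in auto)
  have lk: "lie_alg K = so_of ?E"
    unfolding f(2) by (rule lie_alg_SO_of[OF mink_projection_timelike[OF f(1)] pos])
  have ds: "subspace P" "so_of ?E \<inter> P = {0}" "P \<subseteq> so_of UNIV"
  proof -
    have d: "direct_sum (so_of UNIV) (so_of ?E) P"
      using sd by (simp add: symmetric_decomposition_def lie_alg_SO0 lk)
    then show "subspace P" "so_of ?E \<inter> P = {0}" by (simp_all add: direct_sum_def)
    show "P \<subseteq> so_of UNIV"
    proof
      fix X assume "X \<in> P"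
      then have "0 + X \<in> {X + Y |X Y. X \<in> so_of ?E \<and> Y \<in> P}"
        using subspace_0[OF subspace_so_of] by blast
      then show "X \<in> so_of UNIV" using d by (simp add: direct_sum_def)
    qed
  qed
  have "0 \<in> Ad_fixed H P" using subspace_0[OF ds(1)] by (simp add: Ad_fixed_def Ad_def)
  then obtain X where X: "X \<in> P" "X \<noteq> 0" "\<And>h. h \<in> H \<Longrightarrow> Ad h X = X"
    using fx by (auto simp: Ad_fixed_def)
  have sk: "skew X" using X(1) ds(3) so_of_UNIV_iff by blast
  define x where "x = X *v f"
  have "x \<noteq> 0"
  proof
    assume "x = 0"
    then have "X \<in> so_of ?E" using sk by (simp add: so_of_orth_iff x_def)
    then show False using ds(2) X(1,2) by blast
  qed
  have xE: "x \<in> ?E" unfolding x_def by (rule skew_split_timelike(1)[OF f(1) sk])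
  have xx: "mink x x > 0" by (rule pos_def_onD[OF pos xE \<open>x \<noteq> 0\<close>])
  define b where "b = (1 / sqrt (mink x x)) *\<^sub>R x"
  have p: "hyperbolic_pair f b"
    using f xE xx by (simp add: hyperbolic_pair_def b_def mink_orth_insert_iff field_simps)
  have "H \<subseteq> SO_of (mink_orth {f, b})"
  proof
    fix h assume h: "h \<in> H"
    then have hK: "isom h" "det h = 1" "h *v f = f" using K(2) f(2) by (auto simp: SO_of_orth_iff)
    have "x = Ad h X *v f" using X(3)[OF h] by (simp add: x_def)
    also have "\<dots> = h *v x"
      using mat_inv_fix[OF isom_invertible[OF hK(1)] hK(3)] by (simp add: Ad_vec x_def)
    finally have "h *v b = b" by (simp add: b_def)
    then show "h \<in> SO_of (mink_orth {f, b})" using hK by (simp add: SO_of_orth_iff)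
  qed
  moreover have "\<not> H \<subset> SO_of (mink_orth {f, b})"
    using min admissible_SO_of[OF p] unfolding minimal_admissible_def
    by (auto simp: admissible_def)
  ultimately have "H = SO_of (mink_orth {f, b})" by blast
  then show thesis using that p by blast
qed

section \<open>The reductive decomposition\<close>

definition bivector_complement ::
    "real ^ ('n::finite) option \<Rightarrow> real ^ 'n option \<Rightarrow> ('n option) mat set" where
  "bivector_complement a b = {s *\<^sub>R wedge a b + wedge a w + wedge b w' | s w w'.
     w \<in> mink_orth {a, b} \<and> w' \<in> mink_orth {a, b}}"

text \<open>The values at \<open>a\<close> and \<open>b\<close> determine \<open>s\<close>, \<open>w\<close> and \<open>w'\<close>, and then \<open>A\<close> is what remains. This gives existence
  and uniqueness of the decomposition.\<close>

lemma bivector_complement_vec: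
  assumes p: "hyperbolic_pair a b" and w: "w \<in> mink_orth {a, b}" "w' \<in> mink_orth {a, b}"
    and A: "A \<in> so_of (mink_orth {a, b})"
  shows "(A + s *\<^sub>R wedge a b + wedge a w + wedge b w') *v a = s *\<^sub>R b + w"
    "(A + s *\<^sub>R wedge a b + wedge a w + wedge b w') *v b = s *\<^sub>R a - w'"
  using hyperbolic_pairD[OF p] w A by (simp_all add: mink_orth_pair_iff so_of_orth_iff mink_sym)

lemma frame_coordinates_unique:
  assumes p: "hyperbolic_pair a b" and w: "w \<in> mink_orth {a, b}" "v \<in> mink_orth {a, b}"
    and eq: "x *\<^sub>R a + y *\<^sub>R b + w = x' *\<^sub>R a + y' *\<^sub>R b + v"
  shows "x = x'" "y = y'" "w = v"
proof -
  note q = hyperbolic_pairD[OF p]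
  have "mink a (x *\<^sub>R a + y *\<^sub>R b + w) = mink a (x' *\<^sub>R a + y' *\<^sub>R b + v)" by (simp only: eq)
  then show 1: "x = x'" using q w by (simp add: mink_orth_pair_iff)
  have "mink b (x *\<^sub>R a + y *\<^sub>R b + w) = mink b (x' *\<^sub>R a + y' *\<^sub>R b + v)" by (simp only: eq)
  then show 2: "y = y'" using q w by (simp add: mink_orth_pair_iff)
  show "w = v" using eq 1 2 by simp
qed

lemma bivector_decomposition:
  assumes p: "hyperbolic_pair a b" and X: "X \<in> so_of UNIV"
  shows "\<exists>!(A, s, w, w'). A \<in> so_of (mink_orth {a, b}) \<and> w \<in> mink_orth {a, b} \<and> w' \<in> mink_orth {a, b}
      \<and> X = A + s *\<^sub>R wedge a b + wedge a w + wedge b w'"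
    (is "\<exists>!d. ?P d")
proof
  let ?W = "mink_orth {a, b}"
  have sk: "skew X" using X by (simp add: so_of_UNIV_iff)
  define s w w' where d: "s = mink (X *v a) b" "w = orth_part a b (X *v a)" "w' = - orth_part a b (X *v b)"
  define A where "A = X - (s *\<^sub>R wedge a b + wedge a w + wedge b w')"
  have W: "w \<in> ?W" "w' \<in> ?W" using orth_part_in[OF p] by (auto simp: d subspace_neg)
  have Xab: "X *v a = s *\<^sub>R b + w" "X *v b = s *\<^sub>R a - w'" using skew_frame[OF p sk] by (simp_all add: d)
  have "s *\<^sub>R wedge a b + wedge a w + wedge b w' \<in> so_of UNIV"
    by (intro subspace_add subspace_scale subspace_so_of wedge_in_so_of UNIV_I)
  then have "A \<in> so_of UNIV" unfolding A_def using X by (intro subspace_diff subspace_so_of)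
  moreover have "A *v a = 0" "A *v b = 0"
    using bivector_complement_vec[OF p W subspace_0[OF subspace_so_of], of s] Xab
    unfolding A_def matrix_vector_mult_diff_rdistrib by simp_all
  ultimately have "A \<in> so_of ?W" by (simp add: so_of_orth_iff so_of_UNIV_iff)
  then show "?P (A, s, w, w')" using W by (simp add: A_def)
  fix e assume e: "?P e"
  obtain B t v v' where ee: "e = (B, t, v, v')" by (cases e)
  have B: "B \<in> so_of ?W" "v \<in> ?W" "v' \<in> ?W" "X = B + t *\<^sub>R wedge a b + wedge a v + wedge b v'"
    using e by (auto simp: ee)
  have Xab': "X *v a = t *\<^sub>R b + v" "X *v b = t *\<^sub>R a - v'"
    unfolding B(4) by (rule bivector_complement_vec[OF p B(2,3,1)])+
  have 1: "s = t" "w = v"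
    using frame_coordinates_unique[OF p W(1) B(2), of 0 s 0 t] Xab Xab' by simp_all
  then have 2: "w' = v'" using Xab(2) Xab'(2) by simp
  have "B = A" using B(4) by (simp add: A_def 1 2)
  then show "e = (A, s, w, w')" by (simp add: ee 1 2)
qed

lemma subspace_bivector_complement: "subspace (bivector_complement a b)"
proof -
  let ?W = "mink_orth {a, b}"
  have "bivector_complement a b = (\<lambda>(s, w, w'). s *\<^sub>R wedge a b + wedge a w + wedge b w') ` (UNIV \<times> ?W \<times> ?W)"
    by (force simp: bivector_complement_def)
  moreover have "linear (\<lambda>(s :: real, w, w'). s *\<^sub>R wedge a b + wedge a w + wedge b w')"
    by (intro linearI) (auto simp: wedge_add_right wedge_scaleR_right algebra_simps)
  moreover have "subspace (UNIV \<times> ?W \<times> ?W :: (real \<times> _) set)"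
    by (intro subspace_Times) auto
  ultimately show ?thesis by (simp add: linear_subspace_image)
qed

lemma Ad_SO_of_wedge_sum:
  assumes h: "h \<in> SO_of (mink_orth {a, b})"
  shows "Ad h (s *\<^sub>R wedge a b + wedge a w + wedge b w')
    = s *\<^sub>R wedge a b + wedge a (h *v w) + wedge b (h *v w')"
proof -
  have hab: "isom h" "h *v a = a" "h *v b = b" using h by (auto simp: SO_of_orth_iff)
  have "Ad h (s *\<^sub>R X + Y + Z) = s *\<^sub>R Ad h X + Ad h Y + Ad h Z" for X Y Z
    by (simp add: matrix_eq Ad_vec)
  then show ?thesis using hab by (simp add: Ad_wedge)
qed

lemma reductive_decomposition_SO_of:
  assumes p: "hyperbolic_pair a b"
  shows "reductive_decomposition SO0_1n (SO_of (mink_orth {a, b})) (bivector_complement a b)"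
  unfolding reductive_decomposition_def
proof (intro conjI ballI)
  let ?W = "mink_orth {a, b}" and ?M = "bivector_complement a b"
  have lh: "lie_alg (SO_of ?W) = so_of ?W"
    by (rule lie_alg_SO_of[OF mink_projection_pair[OF p] pos_def_on_orth_pair[OF p]])
  show "direct_sum (lie_alg SO0_1n) (lie_alg (SO_of ?W)) ?M"
    unfolding direct_sum_def lie_alg_SO0 lh
  proof (intro conjI subspace_so_of subspace_bivector_complement)
    show "so_of ?W \<inter> ?M = {0}"
    proof
      show "{0} \<subseteq> so_of ?W \<inter> ?M"
        using subspace_0[OF subspace_so_of] subspace_0[OF subspace_bivector_complement] by blast
      show "so_of ?W \<inter> ?M \<subseteq> {0}"
      proof
        fix X assume X: "X \<in> so_of ?W \<inter> ?M"
        then obtain s w w' where W: "w \<in> ?W" "w' \<in> ?W" "X = s *\<^sub>R wedge a b + wedge a w + wedge b w'"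
          by (auto simp: bivector_complement_def)
        have "X *v a = s *\<^sub>R b + w" "X *v b = s *\<^sub>R a - w'"
          using bivector_complement_vec[OF p W(1,2) subspace_0[OF subspace_so_of], of s] W(3) by simp_all
        moreover have "X *v a = 0" "X *v b = 0" using X by (auto simp: so_of_orth_iff)
        ultimately have "s *\<^sub>R b + w = 0" "s *\<^sub>R a - w' = 0" by simp_all
        moreover from this have "s = 0" "w = 0"
          using frame_coordinates_unique[OF p W(1) subspace_0[OF subspace_mink_orth], of 0 s 0 0] by simp_all
        ultimately show "X \<in> {0}" by (simp add: W(3))
      qed
    qed
    show "so_of UNIV = {X + Y |X Y. X \<in> so_of ?W \<and> Y \<in> ?M}"
    proof
      show "so_of UNIV \<subseteq> {X + Y |X Y. X \<in> so_of ?W \<and> Y \<in> ?M}"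
      proof
        fix X :: "('a option) mat" assume "X \<in> so_of UNIV"
        from ex1_implies_ex[OF bivector_decomposition[OF p this]]
        obtain A s w w' where "A \<in> so_of ?W" "w \<in> ?W" "w' \<in> ?W"
          "X = A + s *\<^sub>R wedge a b + wedge a w + wedge b w'" by auto
        moreover from this have "X = A + (s *\<^sub>R wedge a b + wedge a w + wedge b w')"
          by (simp add: add.assoc)
        ultimately show "X \<in> {X + Y |X Y. X \<in> so_of ?W \<and> Y \<in> ?M}"
          unfolding bivector_complement_def by blast
      qed
      have "?M \<subseteq> so_of UNIV"
        by (auto simp: bivector_complement_def intro!: subspace_add subspace_scale subspace_so_of wedge_in_so_of)
      moreover have "so_of ?W \<subseteq> so_of UNIV" by (auto simp: so_of_orth_iff so_of_UNIV_iff)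
      ultimately show "{X + Y |X Y. X \<in> so_of ?W \<and> Y \<in> ?M} \<subseteq> so_of UNIV"
        by (auto intro!: subspace_add[OF subspace_so_of])
    qed
  qed
  fix h X assume h: "h \<in> SO_of ?W" and "X \<in> ?M"
  then obtain s w w' where W: "w \<in> ?W" "w' \<in> ?W" "X = s *\<^sub>R wedge a b + wedge a w + wedge b w'"
    by (auto simp: bivector_complement_def)
  have "Ad h X = s *\<^sub>R wedge a b + wedge a (h *v w) + wedge b (h *v w')"
    using Ad_SO_of_wedge_sum[OF h] W(3) by simp
  moreover have "h *v w \<in> ?W" "h *v w' \<in> ?W" using SO_of_preserves[OF h] W by auto
  ultimately show "Ad h X \<in> ?M" unfolding bivector_complement_def by blast
qed

text \<open>The isotropy group acts on the summands \<open>a \<and> W\<close> and \<open>b \<and> W\<close> as on \<open>W\<close>, whose rotations have no nonzero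
  fixed vector once \<open>dim W \<ge> 2\<close>.\<close>

lemma Ad_fixed_bivector_complement:
  fixes a b :: "real ^ ('n::finite) option"
  assumes n: "CARD('n) \<ge> 3" and p: "hyperbolic_pair a b"
  shows "Ad_fixed (SO_of (mink_orth {a, b})) (bivector_complement a b) = span {wedge a b}"
proof
  let ?W = "mink_orth {a, b}" and ?M = "bivector_complement a b"
  note pos = pos_def_on_orth_pair[OF p]
  have d: "2 \<le> dim ?W" using n dim_orth_pair[OF p] by simp
  show "Ad_fixed (SO_of ?W) ?M \<subseteq> span {wedge a b}"
  proof
    fix X assume "X \<in> Ad_fixed (SO_of ?W) ?M"
    then have "X \<in> ?M" and fx: "\<And>h. h \<in> SO_of ?W \<Longrightarrow> Ad h X = X" by (auto simp: Ad_fixed_def)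
    then obtain s w w' where W: "w \<in> ?W" "w' \<in> ?W" "X = s *\<^sub>R wedge a b + wedge a w + wedge b w'"
      by (auto simp: bivector_complement_def)
    have X: "X *v a = s *\<^sub>R b + w" "X *v b = s *\<^sub>R a - w'"
      using bivector_complement_vec[OF p W(1,2) subspace_0[OF subspace_so_of], of s] W(3) by simp_all
    have "h *v w = w \<and> h *v w' = w'" if h: "h \<in> SO_of ?W" for h
    proof -
      have hab: "h *v a = a" "h *v b = b" "invertible h"
        using h isom_invertible by (auto simp: SO_of_orth_iff)
      have hX: "h *v (X *v a) = X *v a" "h *v (X *v b) = X *v b"
        using fx[OF h] mat_inv_fix[OF hab(3)] hab(1,2) by (metis Ad_vec)+
      then show ?thesis using hab by (simp add: X)
    qed
    then have "w = 0" "w' = 0"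
      using fixed_vector_eq_0[OF _ pos d W(1)] fixed_vector_eq_0[OF _ pos d W(2)] by auto
    then show "X \<in> span {wedge a b}" by (simp add: W(3) span_base span_scale)
  qed
  show "span {wedge a b} \<subseteq> Ad_fixed (SO_of ?W) ?M"
  proof
    fix X assume "X \<in> span {wedge a b}"
    then obtain s where s: "X = s *\<^sub>R wedge a b" by (auto simp: span_singleton)
    have "X \<in> ?M"
      unfolding bivector_complement_def s
      using subspace_0[of ?W] by (force intro: exI[of _ s] exI[of _ 0])
    moreover have "Ad h X = X" if "h \<in> SO_of ?W" for h
      using Ad_SO_of_wedge_sum[OF that, of s 0 0] by (simp add: s)
    ultimately show "X \<in> Ad_fixed (SO_of ?W) ?M" by (simp add: Ad_fixed_def)
  qed
qed

theorem proposition12: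
  fixes e0 e1 :: "real ^ ('n::finite) option"
    and E W :: "(real ^ 'n option) set"
    and G :: "('n option) mat set"
    and M :: "('n option) mat set"
  assumes n: "CARD('n) \<ge> 2"
    and e0: "mink e0 e0 = -1"
    and E: "E = mink_orth {e0}"
    and e1: "e1 \<in> E" "mink e1 e1 = 1"
    and W: "W = E \<inter> mink_orth {e1}"
    and G: "G = SO0_1n"
    and M: "M = {a *\<^sub>R wedge e0 e1 + wedge e0 w + wedge e1 w' | a w w'. w \<in> W \<and> w' \<in> W}"
  shows "(\<forall>H. minimal_admissible G H \<and> class_II G H \<longleftrightarrow>
            (\<exists>g\<in>G. H = (\<lambda>h. g ** h ** matrix_inv g) ` SO_of W))
    \<and> (\<forall>v. \<exists>!(a, b, w). w \<in> W \<and> v = a *\<^sub>R e0 + b *\<^sub>R e1 + w)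
    \<and> lie_alg G = so_of UNIV \<and> so_of UNIV = bivectors (UNIV :: (real ^ 'n option) set)
    \<and> lie_alg (SO_of W) = so_of W \<and> so_of W = bivectors W
    \<and> reductive_decomposition G (SO_of W) M
    \<and> (\<forall>X \<in> so_of UNIV. \<exists>!(A, a, w, w'). A \<in> so_of W \<and> w \<in> W \<and> w' \<in> W
          \<and> X = A + a *\<^sub>R wedge e0 e1 + wedge e0 w + wedge e1 w')
    \<and> (CARD('n) \<ge> 3 \<longrightarrow> Ad_fixed (SO_of W) M = span {wedge e0 e1})"
proof -
  have p: "hyperbolic_pair e0 e1"
    using e0 e1 by (simp add: hyperbolic_pair_def E mink_orth_insert_iff)
  have W': "W = mink_orth {e0, e1}"
    by (auto simp: W E mink_orth_insert_iff mink_orth_pair_iff)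
  have M': "M = bivector_complement e0 e1" by (simp add: M W' bivector_complement_def)
  have "minimal_admissible G H \<and> class_II G H \<longleftrightarrow>
      (\<exists>g\<in>G. H = (\<lambda>h. g ** h ** matrix_inv g) ` SO_of W)" for H
  proof
    assume "minimal_admissible G H \<and> class_II G H"
    then obtain a b where ab: "hyperbolic_pair a b" "H = SO_of (mink_orth {a, b})"
      using minimal_class_II_imp_SO_of unfolding G by blast
    obtain g where g: "g \<in> SO0_1n" "g *v e0 = a \<or> g *v e0 = - a" "g *v e1 = b"
      using SO0_transitive_pairs[OF n p ab(1)] .
    \<comment> \<open>the isotropy group does not see the sign of the timelike vector\<close>
    have "SO_of (mink_orth {g *v e0, g *v e1}) = SO_of (mink_orth {a, b})"
      using g(2,3) by (auto simp: SO_of_orth_iff)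
    then have "H = (\<lambda>h. g ** h ** matrix_inv g) ` SO_of W"
      unfolding W' SO_of_conj[OF SO0_isom[OF g(1)]] ab(2) by simp
    then show "\<exists>g\<in>G. H = (\<lambda>h. g ** h ** matrix_inv g) ` SO_of W" using g(1) G by blast
  next
    assume "\<exists>g\<in>G. H = (\<lambda>h. g ** h ** matrix_inv g) ` SO_of W"
    then obtain g where g: "g \<in> SO0_1n" "H = (\<lambda>h. g ** h ** matrix_inv g) ` SO_of W"
      unfolding G by blast
    have H: "H = SO_of (mink_orth {g *v e0, g *v e1})"
      unfolding g(2) W' SO_of_conj[OF SO0_isom[OF g(1)]] by simp
    have p': "hyperbolic_pair (g *v e0) (g *v e1)"
      by (rule hyperbolic_pair_isom[OF SO0_isom[OF g(1)] p])
    show "minimal_admissible G H \<and> class_II G H"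
      unfolding G H using minimal_admissible_SO_of[OF n p'] class_II_SO_of[OF n p'] by blast
  qed
  moreover have "\<exists>!(a, b, w). w \<in> W \<and> v = a *\<^sub>R e0 + b *\<^sub>R e1 + w" for v
  proof (rule ex1I[of _ "(- mink e0 v, mink e1 v, orth_part e0 e1 v)"])
    show "case (- mink e0 v, mink e1 v, orth_part e0 e1 v) of
        (a, b, w) \<Rightarrow> w \<in> W \<and> v = a *\<^sub>R e0 + b *\<^sub>R e1 + w"
      using orth_part_in[OF p] orth_part_decomp[of v e0 e1] by (simp add: W')
    fix d assume d: "case d of (a, b, w) \<Rightarrow> w \<in> W \<and> v = a *\<^sub>R e0 + b *\<^sub>R e1 + w"
    obtain a b w where dd: "d = (a, b, w)" by (cases d)
    then have w: "w \<in> mink_orth {e0, e1}" and v: "v = a *\<^sub>R e0 + b *\<^sub>R e1 + w" using d by (auto simp: W')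
    have "a *\<^sub>R e0 + b *\<^sub>R e1 + w = (- mink e0 v) *\<^sub>R e0 + mink e1 v *\<^sub>R e1 + orth_part e0 e1 v"
      using v orth_part_decomp[of v e0 e1] by simp
    from frame_coordinates_unique[OF p w orth_part_in[OF p] this]
    show "d = (- mink e0 v, mink e1 v, orth_part e0 e1 v)" by (simp add: dd)
  qed
  moreover have "lie_alg (SO_of W) = so_of W"
    unfolding W' by (rule lie_alg_SO_of[OF mink_projection_pair[OF p] pos_def_on_orth_pair[OF p]])
  moreover have "so_of W = bivectors W"
    unfolding W' by (rule so_of_eq_bivectors[OF mink_projection_pair[OF p]])
  moreover have "so_of UNIV = bivectors (UNIV :: (real ^ 'n option) set)"
    by (rule so_of_eq_bivectors[OF mink_projection_UNIV])
  moreover have "reductive_decomposition G (SO_of W) M"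
    unfolding G W' M' by (rule reductive_decomposition_SO_of[OF p])
  moreover have "Ad_fixed (SO_of W) M = span {wedge e0 e1}" if "CARD('n) \<ge> 3"
    unfolding W' M' by (rule Ad_fixed_bivector_complement[OF that p])
  moreover have "lie_alg G = so_of UNIV" unfolding G by (rule lie_alg_SO0)
  moreover have "\<forall>X \<in> so_of UNIV. \<exists>!(A, a, w, w'). A \<in> so_of W \<and> w \<in> W \<and> w' \<in> W
      \<and> X = A + a *\<^sub>R wedge e0 e1 + wedge e0 w + wedge e1 w'"
    unfolding W' by (intro ballI bivector_decomposition[OF p])
  ultimately show ?thesis by (intro conjI allI impI)
qed

end
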